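(* Let $X$ be a diffusion on $\mathcal{I}$ as in the context, let $\alpha>0$, and let $g\colon\mathcal{I}\to\mathbb{R}$ be a (non-negative, lower semicontinuous) reward function. If the value function $V_\alpha$ of the optimal stopping problem with reward $g$ and discount $\alpha$ satisfies $$V_\alpha(x)=\int_{(x^*,r]}G_\alpha(x,y)\,(\alpha-L)g(y)\,m(dy)\qquad(x\in\mathcal{I})$$ for some $x^*\in(\ell,r)$, then $V_\alpha$ is differentiable at $x^*$ with respect to $\psi_\alpha$, i.e. the limit $\lim_{x\to x^*}\frac{V_\alpha(x)-V_\alpha(x^* )}{\psi_\alpha(x)-\psi_\alpha(x^* )}$ exists (and is finite).
   Context: $X=\{X_t\colon t\ge 0\}$ is a non-terminating regular one-dimensional diffusion (in the sense of Itô and McKean) with state space an interval $\mathcal{I}\subseteq\mathbb{R}$ with endpoints $\ell=\inf\mathcal{I}$, $r=\sup\mathcal{I}$, $-\infty\le\ell<r\le\infty$. There are no absorbing or killing boundaries; an endpoint belonging to $\mathcal{I}$ is both entrance and exit (reflecting). $\mathbf{E}_x$ is expectation when $X$ starts at $x$. $\mathbf{T}$ is the set of stopping times of the usual augmentation of the natural filtration of $X$. Fix $\alpha>0$. Optimal stopping problem: given a non-negative lower semicontinuous reward $g\colon\mathcal{I}\to\mathbb{R}$, the value function is $V_\alpha(x)=\sup_{\tau\in\mathbf{T}}\mathbf{E}_x\left(e^{-\alpha\tau}g(X_\tau)\right)$ (with the convention $e^{-\alpha\tau}g(X_\tau)=0$ on $\{\tau=\infty\}$). $s$ and $m$ are the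 scale function and speed measure of $X$. $L$ is the infinitesimal generator; its domain $\mathcal{D}_L$ is the range of the resolvent $R_\alpha u(x)=\int_0^\infty e^{-\alpha t}\mathbf{E}_x(u(X_t))\,dt$ on bounded continuous functions $u$ on $\mathcal I$, with $(\alpha-L)$ inverse to $R_\alpha$. For a function $u\colon\mathcal{I}\to\mathbb{R}$ and $x\in(\ell,r)$, $Lu(x)$ means Feller's differential operator $Lu(x)=\frac{\partial}{\partial m}\frac{\partial^+}{\partial s}u(x)$ whenever it makes sense ($\partial^+/\partial s$ is the right derivative with respect to $s$, and one has $\frac{\partial^+u}{\partial s}(z)-\frac{\partial^+u}{\partial s}(y)=\int_{(y,z]}Lu\,dm$ for $u\in\mathcal D_L$); if $\ell\in\mathcal{I}$, $Lu(\ell)=\lim_{x\to\ell^+}Lu(x)$, and if $r\in\mathcal{I}$, $Lu(r)=\lim_{x\to r^-}Lu(x)$, when the limits exist. $(\alpha-L)u=\alpha u-Lu$. $\varphi_\alpha$ (decreasing) and $\psi_\alpha$ (increasing) are the positive continuous solutions of $\alpha u=Lu$ on $\mathcal{I}$, whose linear combinations give all continuous solutions; with $\tau_z=\inf\{t\colon X_t=z\}$, $\mathbf{E}_x(e^{-\alpha\tau_z})=\psi_\alpha(x)/\psi_\alpha(z)$ for $x\le z$ and $=\varphi_\alpha(x)/\varphi_\alpha(z)$ for $x\ge z$. The Wronskian $w_\alpha=\frac{\partial^+\psi_\alpha}{\partial s}(x)\varphi_\alpha(x)-\psi_\alpha(x)\frac{\partial^+\varphi_\alpha}{\partial s}(x)$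 is positive and independent of $x$. The Green function is $G_\alpha(x,y)=\int_0^\infty e^{-\alpha t}p(t;x,y)\,dt$, where $p$ is the transition density with respect to $m$; it equals $w_\alpha^{-1}\psi_\alpha(x)\varphi_\alpha(y)$ for $x\le y$ and $w_\alpha^{-1}\psi_\alpha(y)\varphi_\alpha(x)$ for $x\ge y$. Interval convention: $(x,r]$ denotes $\mathcal{I}\cap\{y>x\}$. *)

theory Defs
  imports "HOL-Probability.Probability"
begin

section \<open>Filtrations and stopping times of a real-valued process\<close>

text \<open>Time is indexed by \<^typ>\<open>ennreal\<close>, so that stopping times may take the value \<open>\<top>\<close>; at index
  \<open>\<top>\<close> the natural filtration is the \<open>\<sigma>\<close>-algebra generated by the whole process.\<close>

definition natural_filtration ::
    "'a measure \<Rightarrow> (real \<Rightarrow> 'a \<Rightarrow> real) \<Rightarrow> ennreal \<Rightarrow> 'a measure" where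
  "natural_filtration M X t = sigma (space M)
     {X u -` B \<inter> space M | u B. 0 \<le> u \<and> ennreal u \<le> t \<and> B \<in> sets borel}"

definition right_filtration ::
    "'a measure \<Rightarrow> (real \<Rightarrow> 'a \<Rightarrow> real) \<Rightarrow> ennreal \<Rightarrow> 'a measure" where
  "right_filtration M X t = sigma (space M)
     {A \<in> sets (natural_filtration M X \<top>). \<forall>u>t. A \<in> sets (natural_filtration M X u)}"

text \<open>The usual augmentation: for every initial law \<open>\<mu>\<close> on \<open>I\<close>, the right-continuous filtration is
  completed by the null sets of \<open>P\<^sub>\<mu> = \<integral> P\<^sub>x \<mu>(dx)\<close>, and the completions are intersected over \<open>\<mu>\<close>.
  A set \<open>N\<close> is \<open>P\<^sub>\<mu>\<close>-null iff \<open>P\<^sub>x N = 0\<close> for \<open>\<mu>\<close>-almost every \<open>x\<close>.\<close>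

definition augmented_filtration ::
    "real set \<Rightarrow> 'a measure \<Rightarrow> (real \<Rightarrow> 'a measure) \<Rightarrow> (real \<Rightarrow> 'a \<Rightarrow> real)
      \<Rightarrow> ennreal \<Rightarrow> 'a measure" where
  "augmented_filtration I M P X t = sigma (space M)
     {A. A \<subseteq> space M \<and>
        (\<forall>\<mu>. prob_space \<mu> \<and> sets \<mu> = sets borel \<and> (AE x in \<mu>. x \<in> I) \<longrightarrow>
          (\<exists>B \<in> sets (right_filtration M X t). \<exists>N \<in> sets (natural_filtration M X \<top>).
             (AE x in \<mu>. emeasure (P x) N = 0) \<and> (A - B) \<union> (B - A) \<subseteq> N))}"

definition hitting_time :: "(real \<Rightarrow> 'a \<Rightarrow> real) \<Rightarrow> real \<Rightarrow> 'a \<Rightarrow> ennreal" where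
  "hitting_time X z \<omega> = Inf (ennreal ` {t. 0 \<le> t \<and> X t \<omega> = z})"


section \<open>Regular one-dimensional diffusions\<close>

text \<open>Time-homogeneous strong Markov property with respect to stopping times of the
  right-continuous natural filtration.\<close>

definition strong_markov ::
    "real set \<Rightarrow> 'a measure \<Rightarrow> (real \<Rightarrow> 'a measure) \<Rightarrow> (real \<Rightarrow> 'a \<Rightarrow> real) \<Rightarrow> bool" where
  "strong_markov I M P X \<longleftrightarrow>
     (\<forall>\<tau>. stopping_time (right_filtration M X) \<tau> \<longrightarrow>
       (\<forall>x\<in>I. \<forall>A \<in> sets (filtration.pre_sigma (space M) (right_filtration M X) \<tau>).
         \<forall>B \<in> sets borel. \<forall>t\<ge>0.
           emeasure (P x) {\<omega>\<in>A. \<tau> \<omega> < \<top> \<and> X (enn2real (\<tau> \<omega>) + t) \<omega> \<in> B} =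
           (\<integral>\<^sup>+\<omega>. indicator {\<omega>\<in>A. \<tau> \<omega> < \<top>} \<omega> *
              emeasure (P (X (enn2real (\<tau> \<omega>)) \<omega>)) {\<omega>'\<in>space M. X t \<omega>' \<in> B} \<partial>P x)))"

text \<open>Paths live in \<open>I\<close> for all times, so the process is non-terminating and an endpoint outside
  \<open>I\<close> is never reached. The regularity clause ranges over all of \<open>I\<close>: an endpoint in \<open>I\<close> can be
  reached from the interior (exit) and left towards the interior (entrance), hence it is
  reflecting and never absorbing.\<close>

definition regular_diffusion ::
    "real set \<Rightarrow> 'a measure \<Rightarrow> (real \<Rightarrow> 'a measure) \<Rightarrow> (real \<Rightarrow> 'a \<Rightarrow> real) \<Rightarrow> bool" where
  "regular_diffusion I M P X \<longleftrightarrow>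
     is_interval I \<and> interior I \<noteq> {} \<and>
     (\<forall>t\<ge>0. X t \<in> borel_measurable M) \<and>
     (\<forall>\<omega>\<in>space M. continuous_on {0..} (\<lambda>t. X t \<omega>) \<and> (\<forall>t\<ge>0. X t \<omega> \<in> I)) \<and>
     (\<forall>x\<in>I. prob_space (P x) \<and> sets (P x) = sets M \<and> (AE \<omega> in P x. X 0 \<omega> = x)) \<and>
     (\<forall>A \<in> sets (natural_filtration M X \<top>).
        (\<lambda>x. emeasure (P x) A) \<in> borel_measurable (restrict_space borel I)) \<and>
     strong_markov I M P X \<and>
     (\<forall>x\<in>I. \<forall>y\<in>I. 0 < emeasure (P x) {\<omega>\<in>space M. hitting_time X y \<omega> < \<top>})"


section \<open>Resolvent and generator\<close>

definition resolvent ::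
    "(real \<Rightarrow> 'a measure) \<Rightarrow> (real \<Rightarrow> 'a \<Rightarrow> real) \<Rightarrow> real \<Rightarrow> (real \<Rightarrow> real) \<Rightarrow> real \<Rightarrow> real" where
  "resolvent P X \<beta> u x =
     (LINT t:{0..}|lborel. exp (- \<beta> * t) * (LINT \<omega>|P x. u (X t \<omega>)))"

text \<open>\<open>generator I P X u v\<close>: \<open>u\<close> is in the domain of the infinitesimal generator and \<open>v\<close> is its
  image, i.e. \<open>u\<close> is the resolvent of the bounded continuous function \<open>\<beta> u - v\<close> (both functions
  matter on \<open>I\<close> only). By the resolvent equation the choice of \<open>\<beta> > 0\<close> is irrelevant.\<close>

definition generator ::
    "real set \<Rightarrow> (real \<Rightarrow> 'a measure) \<Rightarrow> (real \<Rightarrow> 'a \<Rightarrow> real)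
      \<Rightarrow> (real \<Rightarrow> real) \<Rightarrow> (real \<Rightarrow> real) \<Rightarrow> bool" where
  "generator I P X u v \<longleftrightarrow>
     (\<exists>\<beta>>0. \<exists>w. continuous_on I w \<and> bounded (w ` I) \<and>
        (\<forall>x\<in>I. u x = resolvent P X \<beta> w x \<and> v x = \<beta> * u x - w x))"


section \<open>Feller's differential operator\<close>

abbreviation scale_quotient ::
    "(real \<Rightarrow> real) \<Rightarrow> (real \<Rightarrow> real) \<Rightarrow> real \<Rightarrow> real \<Rightarrow> real" where
  "scale_quotient s u x y \<equiv> (u y - u x) / (s y - s x)"

definition has_right_scale_deriv ::
    "(real \<Rightarrow> real) \<Rightarrow> (real \<Rightarrow> real) \<Rightarrow> real \<Rightarrow> real \<Rightarrow> bool" where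
  "has_right_scale_deriv s u x d \<longleftrightarrow> (scale_quotient s u x \<longlongrightarrow> d) (at_right x)"

definition right_scale_deriv :: "(real \<Rightarrow> real) \<Rightarrow> (real \<Rightarrow> real) \<Rightarrow> real \<Rightarrow> real" where
  "right_scale_deriv s u x = (THE d. has_right_scale_deriv s u x d)"

text \<open>\<open>\<partial>/\<partial>m\<close> at \<open>x\<close> is the limit of the increment ratio over intervals \<open>(a, b]\<close> with \<open>a < x < b\<close>
  shrinking to \<open>x\<close>. This is the ordinary two-sided derivative of \<open>\<partial>\<^sup>+u/\<partial>s\<close> with respect to \<open>m\<close>
  when there is no atom at \<open>x\<close>, and the jump of \<open>\<partial>\<^sup>+u/\<partial>s\<close> divided by \<open>m {x}\<close> when there is one.\<close>

definition has_feller_deriv_interior ::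
    "(real \<Rightarrow> real) \<Rightarrow> real measure \<Rightarrow> (real \<Rightarrow> real) \<Rightarrow> real \<Rightarrow> real \<Rightarrow> bool" where
  "has_feller_deriv_interior s m u x c \<longleftrightarrow>
     (\<forall>\<^sub>F y in nhds x. \<exists>d. has_right_scale_deriv s u y d) \<and>
     ((\<lambda>(a, b). (right_scale_deriv s u b - right_scale_deriv s u a) / measure m {a<..b})
        \<longlongrightarrow> c) (at_left x \<times>\<^sub>F at_right x)"

definition has_feller_deriv ::
    "real set \<Rightarrow> (real \<Rightarrow> real) \<Rightarrow> real measure \<Rightarrow> (real \<Rightarrow> real) \<Rightarrow> real \<Rightarrow> real \<Rightarrow> bool" where
  "has_feller_deriv I s m u x c \<longleftrightarrow>
     (if x \<in> interior I then has_feller_deriv_interior s m u x c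
      else (let F = (if \<forall>y\<in>I. x \<le> y then at_right x else at_left x) in
        (\<forall>\<^sub>F y in F. \<exists>d. has_feller_deriv_interior s m u y d) \<and>
        ((\<lambda>y. THE d. has_feller_deriv_interior s m u y d) \<longlongrightarrow> c) F))"

definition feller_op ::
    "real set \<Rightarrow> (real \<Rightarrow> real) \<Rightarrow> real measure \<Rightarrow> (real \<Rightarrow> real) \<Rightarrow> real \<Rightarrow> real" where
  "feller_op I s m u x = (THE c. has_feller_deriv I s m u x c)"


section \<open>Scale function, speed measure, transition density\<close>

definition scale_function ::
    "real set \<Rightarrow> 'a measure \<Rightarrow> (real \<Rightarrow> 'a measure) \<Rightarrow> (real \<Rightarrow> 'a \<Rightarrow> real)
      \<Rightarrow> (real \<Rightarrow> real) \<Rightarrow> bool" where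
  "scale_function I M P X s \<longleftrightarrow>
     continuous_on I s \<and> strict_mono_on I s \<and>
     (\<forall>a\<in>I. \<forall>b\<in>I. \<forall>x. a < x \<and> x < b \<longrightarrow>
        measure (P x) {\<omega>\<in>space M. hitting_time X b \<omega> < hitting_time X a \<omega>}
          = (s x - s a) / (s b - s a))"

text \<open>The speed measure is the measure for which the generator is \<open>\<partial>/\<partial>m \<partial>\<^sup>+/\<partial>s\<close>. The last two clauses
  are the boundary conditions of a (possibly sticky) reflecting endpoint; they determine the mass
  of \<open>m\<close> there.\<close>

definition speed_measure ::
    "real set \<Rightarrow> (real \<Rightarrow> 'a measure) \<Rightarrow> (real \<Rightarrow> 'a \<Rightarrow> real)
      \<Rightarrow> (real \<Rightarrow> real) \<Rightarrow> real measure \<Rightarrow> bool" where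
  "speed_measure I P X s m \<longleftrightarrow>
     sets m = sets borel \<and> emeasure m (- I) = 0 \<and>
     (\<forall>a\<in>I. \<forall>b\<in>I. a < b \<longrightarrow> 0 < emeasure m {a<..<b} \<and> emeasure m {a..b} < \<top>) \<and>
     (\<forall>u v. generator I P X u v \<longrightarrow>
        (\<forall>y\<in>interior I. \<exists>d. has_right_scale_deriv s u y d) \<and>
        (\<forall>y\<in>interior I. \<forall>z\<in>interior I. y < z \<longrightarrow>
           right_scale_deriv s u z - right_scale_deriv s u y = (LINT x:{y<..z}|m. v x)) \<and>
        (\<forall>l\<in>I. (\<forall>y\<in>I. l \<le> y) \<longrightarrow>
           (scale_quotient s u l \<longlongrightarrow> measure m {l} * v l) (at_right l)) \<and>
        (\<forall>r\<in>I. (\<forall>y\<in>I. y \<le> r) \<longrightarrow>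
           (scale_quotient s u r \<longlongrightarrow> - measure m {r} * v r) (at_left r)))"

definition transition_density ::
    "real set \<Rightarrow> 'a measure \<Rightarrow> (real \<Rightarrow> 'a measure) \<Rightarrow> (real \<Rightarrow> 'a \<Rightarrow> real)
      \<Rightarrow> real measure \<Rightarrow> (real \<Rightarrow> real \<Rightarrow> real \<Rightarrow> real) \<Rightarrow> bool" where
  "transition_density I M P X m p \<longleftrightarrow>
     (\<lambda>(t, x, y). p t x y) \<in> borel_measurable (borel \<Otimes>\<^sub>M borel \<Otimes>\<^sub>M borel) \<and>
     (\<forall>t>0. \<forall>x\<in>I. \<forall>y\<in>I. 0 \<le> p t x y) \<and>
     (\<forall>t>0. \<forall>x\<in>I. \<forall>A\<in>sets borel.
        emeasure (P x) {\<omega>\<in>space M. X t \<omega> \<in> A} =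
          (\<integral>\<^sup>+y. ennreal (p t x y) * indicator (A \<inter> I) y \<partial>m))"

definition green_function ::
    "(real \<Rightarrow> real \<Rightarrow> real \<Rightarrow> real) \<Rightarrow> real \<Rightarrow> real \<Rightarrow> real \<Rightarrow> real" where
  "green_function p \<alpha> x y = (LINT t:{0<..}|lborel. exp (- \<alpha> * t) * p t x y)"


section \<open>The functions \<open>\<phi>\<^sub>\<alpha>\<close> and \<open>\<psi>\<^sub>\<alpha>\<close>\<close>

definition discounted_hitting ::
    "(real \<Rightarrow> 'a measure) \<Rightarrow> (real \<Rightarrow> 'a \<Rightarrow> real) \<Rightarrow> real \<Rightarrow> real \<Rightarrow> real \<Rightarrow> real" where
  "discounted_hitting P X \<alpha> x z =
     (LINT \<omega>|P x. (if hitting_time X z \<omega> = \<top> then 0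
                   else exp (- \<alpha> * enn2real (hitting_time X z \<omega>))))"

definition alpha_harmonic ::
    "real set \<Rightarrow> (real \<Rightarrow> real) \<Rightarrow> real measure \<Rightarrow> real \<Rightarrow> (real \<Rightarrow> real) \<Rightarrow> bool" where
  "alpha_harmonic I s m \<alpha> u \<longleftrightarrow>
     continuous_on I u \<and> (\<forall>x\<in>I. has_feller_deriv I s m u x (\<alpha> * u x))"

definition fundamental_solutions ::
    "real set \<Rightarrow> (real \<Rightarrow> 'a measure) \<Rightarrow> (real \<Rightarrow> 'a \<Rightarrow> real) \<Rightarrow> (real \<Rightarrow> real)
      \<Rightarrow> real measure \<Rightarrow> real \<Rightarrow> (real \<Rightarrow> real) \<Rightarrow> (real \<Rightarrow> real) \<Rightarrow> bool" where
  "fundamental_solutions I P X s m \<alpha> \<phi> \<psi> \<longleftrightarrow>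
     alpha_harmonic I s m \<alpha> \<phi> \<and> alpha_harmonic I s m \<alpha> \<psi> \<and>
     (\<forall>x\<in>I. 0 < \<phi> x \<and> 0 < \<psi> x) \<and>
     strict_antimono_on I \<phi> \<and> strict_mono_on I \<psi> \<and>
     (\<forall>u. alpha_harmonic I s m \<alpha> u \<longrightarrow> (\<exists>a b. \<forall>x\<in>I. u x = a * \<phi> x + b * \<psi> x)) \<and>
     (\<forall>x\<in>I. \<forall>z\<in>I.
        (x \<le> z \<longrightarrow> discounted_hitting P X \<alpha> x z = \<psi> x / \<psi> z) \<and>
        (z \<le> x \<longrightarrow> discounted_hitting P X \<alpha> x z = \<phi> x / \<phi> z))"


section \<open>Optimal stopping\<close>

definition lower_semicontinuous_on :: "real set \<Rightarrow> (real \<Rightarrow> real) \<Rightarrow> bool" where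
  "lower_semicontinuous_on I g \<longleftrightarrow> (\<forall>c. openin (top_of_set I) {x\<in>I. c < g x})"

text \<open>Stopping times are measurable only for the completions of the \<^term>\<open>P x\<close>, so expectations are
  taken under \<^term>\<open>completion (P x)\<close>.\<close>

definition value_function ::
    "real set \<Rightarrow> 'a measure \<Rightarrow> (real \<Rightarrow> 'a measure) \<Rightarrow> (real \<Rightarrow> 'a \<Rightarrow> real)
      \<Rightarrow> real \<Rightarrow> (real \<Rightarrow> real) \<Rightarrow> real \<Rightarrow> ennreal" where
  "value_function I M P X \<alpha> g x =
     (SUP \<tau> \<in> {\<tau>. stopping_time (augmented_filtration I M P X) \<tau>}.
        \<integral>\<^sup>+\<omega>. (if \<tau> \<omega> = \<top> then 0
              else ennreal (exp (- \<alpha> * enn2real (\<tau> \<omega>)) * g (X (enn2real (\<tau> \<omega>)) \<omega>)))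
          \<partial>completion (P x))"

end

theory Submission
  imports Defs
begin

text \<open>Let \<open>G\<close> be the Green function, \<open>h = (\<alpha> - L) g\<close> and \<open>a = xs\<close>. The strong Markov
  property at the hitting time of \<open>z\<close> gives \<open>G x y \<ge> E\<^sub>x (exp (- \<alpha> \<tau>\<^sub>z)) * G z y\<close> for almost
  every \<open>y\<close>, with equality if \<open>z\<close> separates \<open>x\<close> from \<open>y\<close>; the explicit formula for \<open>G\<close> is
  not needed. Hence \<open>V x = \<psi> x / \<psi> a * V a\<close> for \<open>x \<le> a\<close>, while for \<open>x > a\<close> the two sides
  differ by at most \<open>(\<psi> x / \<psi> a - \<phi> x / \<phi> a) * \<integral>\<^bsub>(a, x]\<^esub> G a y * \<bar>h y\<bar> m(dy)\<close>.
  The integral tends to \<open>0\<close> as \<open>x\<close> decreases to \<open>a\<close>, and the factor is \<open>O(\<psi> x - \<psi> a)\<close>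
  because \<open>\<phi>\<close> and \<open>\<psi>\<close> have right scale derivatives at \<open>a\<close> and that of \<open>\<psi>\<close> is positive.
  So the derivative is \<open>V a / \<psi> a\<close>.\<close>

section \<open>Hitting times of continuous processes\<close>

lemma space_natural_filtration [simp]: "space (natural_filtration M X t) = space M"
  unfolding natural_filtration_def by (rule space_measure_of) auto

lemma sets_natural_filtration:
  "sets (natural_filtration M X t) = sigma_sets (space M)
     {X u -` B \<inter> space M | u B. 0 \<le> u \<and> ennreal u \<le> t \<and> B \<in> sets borel}"
  unfolding natural_filtration_def by (rule sets_measure_of) auto

lemma sets_natural_filtration_mono:
  "t \<le> t' \<Longrightarrow> sets (natural_filtration M X t) \<subseteq> sets (natural_filtration M X t')"
  unfolding sets_natural_filtration by (rule sigma_sets_mono') (auto intro: order_trans)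

lemma measurable_natural_filtration:
  assumes "0 \<le> u" "ennreal u \<le> t"
  shows "X u \<in> borel_measurable (natural_filtration M X t)"
proof (rule measurableI)
  fix B :: "real set" assume "B \<in> sets borel"
  then show "X u -` B \<inter> space (natural_filtration M X t) \<in> sets (natural_filtration M X t)"
    unfolding sets_natural_filtration using assms by (auto intro!: sigma_sets.Basic)
qed simp

lemma sets_natural_filtration_subset:
  assumes "\<And>u. 0 \<le> u \<Longrightarrow> X u \<in> borel_measurable M"
  shows "sets (natural_filtration M X t) \<subseteq> sets M"
  unfolding sets_natural_filtration
  by (rule sets.sigma_sets_subset) (auto intro: measurable_sets[OF assms])

lemma space_right_filtration [simp]: "space (right_filtration M X t) = space M"
  unfolding right_filtration_def
  by (rule space_measure_of) (use sets.space_closed[of "natural_filtration M X \<top>"] in auto)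

lemma sets_right_filtration:
  "sets (right_filtration M X t) = sigma_sets (space M)
     {A \<in> sets (natural_filtration M X \<top>). \<forall>u>t. A \<in> sets (natural_filtration M X u)}"
  unfolding right_filtration_def
  by (rule sets_measure_of) (use sets.space_closed[of "natural_filtration M X \<top>"] in auto)

lemma filtration_right_filtration: "filtration (space M) (right_filtration M X)"
proof
  show "sets (right_filtration M X i) \<subseteq> sets (right_filtration M X j)" if "i \<le> j" for i j
    unfolding sets_right_filtration using that by (intro sigma_sets_mono') auto
qed simp

lemma sets_natural_le_right: "sets (natural_filtration M X t) \<subseteq> sets (right_filtration M X t)"
  unfolding sets_right_filtration
  using sets_natural_filtration_mono[of t _ M X]
  by (auto intro!: sigma_sets.Basic simp: less_imp_le subset_iff)

lemma sets_right_filtration_subset: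
  assumes "\<And>u. 0 \<le> u \<Longrightarrow> X u \<in> borel_measurable M"
  shows "sets (right_filtration M X t) \<subseteq> sets M"
  unfolding sets_right_filtration
  using sets_natural_filtration_subset[of X M \<top>, OF assms]
  by (intro sets.sigma_sets_subset) auto

section \<open>Hitting times of a level as stopping times\<close>

text \<open>The times at which a continuous path sits at \<open>z\<close> form a closed set bounded
  below, so the infimum is attained as soon as this set is nonempty. It is nonempty here because the
  infimum of the empty set is \<top>, above every real bound.\<close>

lemma hitting_time_le_iff:
  assumes cont: "continuous_on {0..} (\<lambda>t. X t \<omega>)" and t: "0 \<le> t"
  shows "hitting_time X z \<omega> \<le> ennreal t \<longleftrightarrow> (\<exists>u\<in>{0..t}. X u \<omega> = z)"
proof
  assume "\<exists>u\<in>{0..t}. X u \<omega> = z"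
  then obtain u where u: "0 \<le> u" "u \<le> t" "X u \<omega> = z" by auto
  then show "hitting_time X z \<omega> \<le> ennreal t"
    unfolding hitting_time_def by (intro Inf_lower2[of "ennreal u"]) auto
next
  assume le: "hitting_time X z \<omega> \<le> ennreal t"
  define S where "S = {u. 0 \<le> u \<and> X u \<omega> = z}"
  have "S \<noteq> {}"
    using le by (auto simp: hitting_time_def S_def[symmetric] top_unique)
  moreover have "closed S"
    using continuous_closed_preimage[OF cont, of "{z}"]
    by (auto simp: S_def vimage_def Int_def)
  ultimately have Inf: "Inf S \<in> S"
    by (intro closed_contains_Inf) (auto simp: S_def bdd_below_def)
  have "ennreal (Inf S) \<le> hitting_time X z \<omega>"
    unfolding hitting_time_def S_def[symmetric]
    by (intro Inf_greatest) (auto intro!: ennreal_leI cInf_lower simp: bdd_below_def S_def)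
  with le have "Inf S \<le> t"
    using t by (metis ennreal_le_iff order_trans)
  with Inf show "\<exists>u\<in>{0..t}. X u \<omega> = z"
    by (auto simp: S_def)
qed

text \<open>The attainment criterion is applied at the hitting time itself. The visit it yields is
  not later than the infimum and, being a visit, not earlier either.\<close>

lemma at_hitting_time:
  assumes cont: "continuous_on {0..} (\<lambda>t. X t \<omega>)" and fin: "hitting_time X z \<omega> < \<top>"
  shows "X (enn2real (hitting_time X z \<omega>)) \<omega> = z"
proof -
  define t where "t = enn2real (hitting_time X z \<omega>)"
  have t: "hitting_time X z \<omega> = ennreal t" "0 \<le> t"
    using fin by (auto simp: t_def)
  then obtain u where u: "0 \<le> u" "u \<le> t" "X u \<omega> = z"
    using hitting_time_le_iff[where X=X, OF cont \<open>0 \<le> t\<close>, of z] by auto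
  then have "ennreal t \<le> ennreal u"
    using hitting_time_le_iff[where X=X, OF cont \<open>0 \<le> u\<close>, of z] t by auto
  with u show ?thesis
    by (simp add: t_def[symmetric])
qed

text \<open>On the compact interval \<open>{0..t}\<close> a continuous path meets \<open>z\<close>
  exactly if it comes arbitrarily close to \<open>z\<close>, and by continuity closeness can be
  tested at rational times. This leaves a countable combination of events known at time
  \<open>t\<close>.\<close>

lemma hitting_time_sets_natural:
  assumes cont: "\<And>\<omega>. \<omega> \<in> space M \<Longrightarrow> continuous_on {0..} (\<lambda>t. X t \<omega>)" and t: "0 \<le> t"
  shows "{\<omega>\<in>space M. hitting_time X z \<omega> \<le> ennreal t} \<in> sets (natural_filtration M X (ennreal t))"
proof -
  \<comment> \<open>Clamping to \<open>{0..t}\<close> lets \<open>q\<close> range over all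
    rationals: a visit at time \<open>t\<close> itself is approached from the right by rationals
    beyond \<open>t\<close>, which the clamp sends back to \<open>t\<close>.\<close>
  define c where "c = (\<lambda>q::real. max 0 (min t q))"
  have c: "0 \<le> c q" "c q \<le> t" for q
    using t by (auto simp: c_def)
  have iff: "hitting_time X z \<omega> \<le> ennreal t \<longleftrightarrow> (\<forall>n. \<exists>q\<in>\<rat>. \<bar>X (c q) \<omega> - z\<bar> < 1 / real (Suc n))"
    if "\<omega> \<in> space M" for \<omega>
    unfolding hitting_time_le_iff[where X=X, OF cont[OF that] t]
  proof
    assume "\<exists>u\<in>{0..t}. X u \<omega> = z"
    then obtain u where u: "0 \<le> u" "u \<le> t" "X u \<omega> = z" by auto
    then have cu: "c u = u" by (simp add: c_def)
    have cts: "continuous_on UNIV (\<lambda>q. \<bar>X (c q) \<omega> - z\<bar>)"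
      unfolding c_def
      by (intro continuous_intros continuous_on_compose2[OF cont[OF that]]) auto
    show "\<forall>n. \<exists>q\<in>\<rat>. \<bar>X (c q) \<omega> - z\<bar> < 1 / real (Suc n)"
    proof
      fix n
      have "open {q. \<bar>X (c q) \<omega> - z\<bar> < 1 / real (Suc n)}"
        by (intro open_Collect_less cts continuous_intros)
      moreover have "u \<in> {q. \<bar>X (c q) \<omega> - z\<bar> < 1 / real (Suc n)}"
        using u cu by simp
      ultimately obtain e where e: "0 < e" "ball u e \<subseteq> {q. \<bar>X (c q) \<omega> - z\<bar> < 1 / real (Suc n)}"
        by (meson open_contains_ball)
      obtain q where "q \<in> \<rat>" "u < q" "q < u + e"
        using Rats_dense_in_real[of u "u + e"] e by auto
      moreover then have "q \<in> ball u e"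
        by (auto simp: dist_real_def)
      ultimately show "\<exists>q\<in>\<rat>. \<bar>X (c q) \<omega> - z\<bar> < 1 / real (Suc n)"
        using e by auto
    qed
  next
    assume small: "\<forall>n. \<exists>q\<in>\<rat>. \<bar>X (c q) \<omega> - z\<bar> < 1 / real (Suc n)"
    \<comment> \<open>The distance to \<open>z\<close> attains its minimum on the compact interval,
      and the approximations force this minimum to be 0.\<close>
    have "continuous_on {0..t} (\<lambda>u. \<bar>X u \<omega> - z\<bar>)"
      by (intro continuous_intros continuous_on_subset[OF cont[OF that]]) auto
    then obtain u where u: "u \<in> {0..t}" "\<And>v. v \<in> {0..t} \<Longrightarrow> \<bar>X u \<omega> - z\<bar> \<le> \<bar>X v \<omega> - z\<bar>"
      using continuous_attains_inf[of "{0..t}" "\<lambda>u. \<bar>X u \<omega> - z\<bar>"] t by auto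
    have "\<bar>X u \<omega> - z\<bar> \<le> 0"
    proof (rule ccontr)
      assume "\<not> ?thesis"
      then obtain n where "1 / real (Suc n) < \<bar>X u \<omega> - z\<bar>"
        by (meson nat_approx_posE not_le)
      moreover obtain q where "\<bar>X (c q) \<omega> - z\<bar> < 1 / real (Suc n)"
        using small by auto
      ultimately show False
        using u(2)[of "c q"] c[of q] by auto
    qed
    with u show "\<exists>u\<in>{0..t}. X u \<omega> = z" by auto
  qed
  have [measurable]: "X (c q) \<in> borel_measurable (natural_filtration M X (ennreal t))" for q
    using c[of q] by (intro measurable_natural_filtration) (auto intro: ennreal_leI)
  have "Measurable.pred (natural_filtration M X (ennreal t))
      (\<lambda>\<omega>. \<forall>n. \<exists>q\<in>\<rat>. \<bar>X (c q) \<omega> - z\<bar> < 1 / real (Suc n))"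
    using countable_rat by measurable
  then have "{\<omega>\<in>space M. \<forall>n. \<exists>q\<in>\<rat>. \<bar>X (c q) \<omega> - z\<bar> < 1 / real (Suc n)}
      \<in> sets (natural_filtration M X (ennreal t))"
    by (simp add: pred_def)
  also have "{\<omega>\<in>space M. \<forall>n. \<exists>q\<in>\<rat>. \<bar>X (c q) \<omega> - z\<bar> < 1 / real (Suc n)} =
      {\<omega>\<in>space M. hitting_time X z \<omega> \<le> ennreal t}"
    using iff by auto
  finally show ?thesis .
qed

lemma stopping_time_hitting_time:
  assumes cont: "\<And>\<omega>. \<omega> \<in> space M \<Longrightarrow> continuous_on {0..} (\<lambda>t. X t \<omega>)"
  shows "stopping_time (right_filtration M X) (hitting_time X z)"
proof
  fix t
  show "Measurable.pred (right_filtration M X t) (\<lambda>\<omega>. hitting_time X z \<omega> \<le> t)"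
  proof (cases t)
    case (real u)
    then show ?thesis
      using hitting_time_sets_natural[where X=X and t=u and z=z, OF cont] sets_natural_le_right[of M X t]
      by (auto simp: pred_def)
  qed simp
qed

section \<open>Joint measurability in time and path\<close>

text \<open>A path is the limit of its values along grids of mesh \<open>1 / Suc n\<close>, and each
  grid involves only countably many random variables. Time is clamped at 0 because \<open>X\<close>
  is controlled at nonnegative times only.\<close>

lemma jointly_measurable_process:
  fixes X :: "real \<Rightarrow> 'a \<Rightarrow> real"
  assumes meas: "\<And>t. 0 \<le> t \<Longrightarrow> X t \<in> borel_measurable M"
    and cont: "\<And>\<omega>. \<omega> \<in> space M \<Longrightarrow> continuous_on {0..} (\<lambda>t. X t \<omega>)"
  shows "(\<lambda>(t, \<omega>). X (max 0 t) \<omega>) \<in> borel_measurable (borel \<Otimes>\<^sub>M M)"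
proof (rule borel_measurable_LIMSEQ_real)
  define d where "d = (\<lambda>(n::nat) t::real. real_of_int \<lfloor>t * real (Suc n)\<rfloor> / real (Suc n))"
  have lim: "(\<lambda>n. d n t) \<longlonglongrightarrow> t" for t
  proof -
    have "(\<lambda>n. d n t - t) \<longlonglongrightarrow> 0"
    proof (rule Lim_null_comparison)
      show "(\<lambda>n. inverse (real (Suc n))) \<longlonglongrightarrow> 0" by (rule LIMSEQ_inverse_real_of_nat)
      show "\<forall>\<^sub>F n in sequentially. norm (d n t - t) \<le> inverse (real (Suc n))"
      proof (intro always_eventually allI)
        fix n
        have "\<bar>real_of_int \<lfloor>t * real (Suc n)\<rfloor> - t * real (Suc n)\<bar> \<le> 1" by linarith
        then have "\<bar>(d n t - t) * real (Suc n)\<bar> \<le> 1"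
          by (simp add: d_def left_diff_distrib del: of_nat_Suc)
        then show "norm (d n t - t) \<le> inverse (real (Suc n))"
          by (simp add: abs_mult inverse_eq_divide pos_le_divide_eq del: of_nat_Suc)
      qed
    qed
    then show ?thesis
      by (simp add: LIM_zero_iff)
  qed
  show "(\<lambda>n. case y of (t, \<omega>) \<Rightarrow> X (max 0 (d n t)) \<omega>) \<longlonglongrightarrow> (case y of (t, \<omega>) \<Rightarrow> X (max 0 t) \<omega>)"
    if y_in: "y \<in> space (borel \<Otimes>\<^sub>M M)" for y
  proof -
    obtain t \<omega> where y: "y = (t, \<omega>)" "\<omega> \<in> space M"
      using y_in by (cases y) (auto simp: space_pair_measure)
    show ?thesis
      unfolding y(1) prod.case
      by (rule continuous_on_tendsto_compose[OF cont[OF y(2)], of "\<lambda>n. max 0 (d n t)"])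
         (auto intro!: tendsto_intros lim)
  qed
  show "(\<lambda>y. case y of (t, \<omega>) \<Rightarrow> X (max 0 (d n t)) \<omega>) \<in> borel_measurable (borel \<Otimes>\<^sub>M M)" for n
  proof -
    have [measurable]: "X (max 0 u) \<in> borel_measurable M" for u
      by (rule meas) simp
    have "(\<lambda>y. (\<lambda>i y. X (max 0 (real_of_int i / real (Suc n))) (snd y))
        \<lfloor>fst y * real (Suc n)\<rfloor> y) \<in> borel_measurable (borel \<Otimes>\<^sub>M M)"
      by (rule measurable_compose_countable) measurable
    then show ?thesis
      by (simp add: d_def case_prod_beta')
  qed
qed

text \<open>The tail of the exponential law with rate \<alpha>. It serves to write a discount factor
  as a mixture of indicators, and at \<open>t = 0\<close> it gives the total mass of the discounted
  time.\<close>

lemma nn_integral_exp_tail: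
  assumes "0 < (\<alpha>::real)"
  shows "(\<integral>\<^sup>+c. ennreal (\<alpha> * exp (- \<alpha> * c)) * indicator {t..} c \<partial>lborel) = ennreal (exp (- \<alpha> * t))"
proof -
  have "(\<integral>\<^sup>+c. ennreal (\<alpha> * exp (- \<alpha> * c)) * indicator {t..} c \<partial>lborel)
      = ennreal (0 - (- exp (- \<alpha> * t)))"
  proof (rule nn_integral_FTC_atLeast)
    show "((\<lambda>c. - exp (- \<alpha> * c)) \<longlongrightarrow> 0) at_top"
      using assms
      by (auto intro!: tendsto_minus_cancel_left[THEN iffD1] filterlim_compose[OF exp_at_bot]
          filterlim_tendsto_pos_mult_at_top[OF tendsto_const] filterlim_ident
          simp: filterlim_uminus_at_bot)
  qed (use assms in \<open>auto intro!: derivative_eq_intros\<close>)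
  then show ?thesis by simp
qed

section \<open>Discounted occupation measures and the strong Markov property\<close>

text \<open>The integrand lies between 0 and 1, so it is integrable and the Bochner integral agrees
  with the nonnegative one, for which Tonelli is available.\<close>

lemma ennreal_discounted_hitting:
  assumes "prob_space (P x)" and [measurable]: "hitting_time X z \<in> borel_measurable (P x)"
    and \<alpha>: "0 < \<alpha>"
  shows "ennreal (discounted_hitting P X \<alpha> x z) =
    (\<integral>\<^sup>+\<omega>. (if hitting_time X z \<omega> = \<top> then 0
        else ennreal (exp (- \<alpha> * enn2real (hitting_time X z \<omega>)))) \<partial>P x)"
proof -
  interpret prob_space "P x" by fact
  have "integrable (P x) (\<lambda>\<omega>. if hitting_time X z \<omega> = \<top> then 0
      else exp (- \<alpha> * enn2real (hitting_time X z \<omega>)))"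
    by (rule integrable_const_bound[of _ 1]) (use \<alpha> in auto)
  then show ?thesis
    unfolding discounted_hitting_def
    by (subst nn_integral_eq_integral[symmetric]) (auto intro!: nn_integral_cong)
qed

text \<open>The \<alpha>-potential (resolvent) measure of the process started at \<open>x\<close>.
  It depends on the one-dimensional laws only, and so links path arguments with the transition
  density.\<close>

definition potential :: "(real \<Rightarrow> 'a measure) \<Rightarrow> (real \<Rightarrow> 'a \<Rightarrow> real) \<Rightarrow> real \<Rightarrow> real \<Rightarrow> real set \<Rightarrow> ennreal"
  where "potential P X \<alpha> x B = (\<integral>\<^sup>+t. ennreal (exp (- \<alpha> * t)) * indicator {0..} t *
    emeasure (P x) {\<omega>\<in>space (P x). X t \<omega> \<in> B} \<partial>lborel)"

locale diffusion =
  fixes I :: "real set" and M :: "'a measure" and P :: "real \<Rightarrow> 'a measure"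
    and X :: "real \<Rightarrow> 'a \<Rightarrow> real"
  assumes diffusion: "regular_diffusion I M P X"
begin

lemma process_measurable: "0 \<le> t \<Longrightarrow> X t \<in> borel_measurable M"
  and path_continuous: "\<omega> \<in> space M \<Longrightarrow> continuous_on {0..} (\<lambda>t. X t \<omega>)"
  and prob_space_law: "x \<in> I \<Longrightarrow> prob_space (P x)"
  and sets_law: "x \<in> I \<Longrightarrow> sets (P x) = sets M"
  and AE_start: "x \<in> I \<Longrightarrow> AE \<omega> in P x. X 0 \<omega> = x"
  and strong_markov: "strong_markov I M P X"
  and interval: "is_interval I"
  using diffusion by (simp_all add: regular_diffusion_def)

lemma space_law: "x \<in> I \<Longrightarrow> space (P x) = space M"
  by (rule sets_eq_imp_space_eq) (rule sets_law)

lemma joint_measurable: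
  "(\<lambda>(t, \<omega>). X (max 0 t) \<omega>) \<in> borel_measurable (borel \<Otimes>\<^sub>M M)"
  by (rule jointly_measurable_process[OF process_measurable path_continuous])

lemma joint_measurable_law:
  assumes "x \<in> I"
  shows "(\<lambda>(t, \<omega>). X (max 0 t) \<omega>) \<in> borel_measurable (borel \<Otimes>\<^sub>M P x)"
  using joint_measurable
  by (subst measurable_cong_sets[OF sets_pair_measure_cong[OF refl sets_law[OF assms]] refl])

lemma hitting_time_measurable: "hitting_time X z \<in> borel_measurable M"
  by (rule measurable_stopping_time[OF stopping_time_hitting_time[where X=X and M=M, OF path_continuous]])
    (auto intro: sets_right_filtration_subset[OF process_measurable, THEN subsetD])

section \<open>Discounted strong Markov property at a hitting time\<close>

text \<open>At its hitting time of \<open>z\<close> the process is at \<open>z\<close>, so the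
  kernel in \<open>strong_markov\<close> is constant on the event and leaves the integral. The
  events \<open>hitting_time X z \<omega> \<le> ennreal c\<close> suffice, since the discount factor
  is assembled from them.\<close>

lemma strong_markov_hitting:
  assumes x: "x \<in> I" and z: "z \<in> I" and B: "B \<in> sets borel" and u: "0 \<le> u" and c: "0 \<le> c"
  shows "emeasure (P x) {\<omega>\<in>space M. hitting_time X z \<omega> \<le> ennreal c \<and>
      X (enn2real (hitting_time X z \<omega>) + u) \<omega> \<in> B}
    = emeasure (P x) {\<omega>\<in>space M. hitting_time X z \<omega> \<le> ennreal c} *
      emeasure (P z) {\<omega>\<in>space M. X u \<omega> \<in> B}"
proof -
  let ?T = "hitting_time X z"
  define A where "A = {\<omega>\<in>space M. ?T \<omega> \<le> ennreal c}"
  have ST: "stopping_time (right_filtration M X) ?T"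
    by (rule stopping_time_hitting_time[OF path_continuous])
  have fin: "?T \<omega> < \<top>" if "\<omega> \<in> A" for \<omega>
    using that by (auto simp: A_def intro: le_less_trans)
  interpret F: filtration "space M" "right_filtration M X"
    by (rule filtration_right_filtration)
  have "A \<in> sets (F.pre_sigma ?T)"
    using measurable_sets[OF F.measurable_stopping_time_pre_sigma[OF ST], of "{..ennreal c}"]
    by (auto simp: A_def F.space_pre_sigma vimage_def Int_def conj_commute)
  then have "emeasure (P x) {\<omega>\<in>A. ?T \<omega> < \<top> \<and> X (enn2real (?T \<omega>) + u) \<omega> \<in> B} =
     (\<integral>\<^sup>+\<omega>. indicator {\<omega>\<in>A. ?T \<omega> < \<top>} \<omega> *
        emeasure (P (X (enn2real (?T \<omega>)) \<omega>)) {\<omega>'\<in>space M. X u \<omega>' \<in> B} \<partial>P x)"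
    using strong_markov ST x B u unfolding strong_markov_def by blast
  also have "\<dots> = (\<integral>\<^sup>+\<omega>. indicator A \<omega> * emeasure (P z) {\<omega>'\<in>space M. X u \<omega>' \<in> B} \<partial>P x)"
    using at_hitting_time[where X=X and z=z, OF path_continuous] fin
    by (intro nn_integral_cong) (auto simp: space_law[OF x] indicator_def)
  also have "\<dots> = emeasure (P x) A * emeasure (P z) {\<omega>'\<in>space M. X u \<omega>' \<in> B}"
  proof -
    have "A \<in> sets (P x)"
      using hitting_time_measurable[of z] by (simp add: A_def sets_law[OF x])
    then show ?thesis
      by (simp add: nn_integral_multc)
  qed
  also have "{\<omega>\<in>A. ?T \<omega> < \<top> \<and> X (enn2real (?T \<omega>) + u) \<omega> \<in> B} =
      {\<omega>\<in>space M. ?T \<omega> \<le> ennreal c \<and> X (enn2real (?T \<omega>) + u) \<omega> \<in> B}"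
    using fin by (auto simp: A_def)
  finally show ?thesis
    by (simp add: A_def)
qed

context
  fixes \<alpha> :: real and x z :: real
  assumes \<alpha>: "0 < \<alpha>" and x: "x \<in> I" and z: "z \<in> I"
begin

interpretation prob_space "P x"
  by (rule prob_space_law[OF x])

lemma measurable_law:
  "hitting_time X z \<in> borel_measurable (P x)"
  "(\<lambda>(t, \<omega>). X (max 0 t) \<omega>) \<in> borel_measurable (borel \<Otimes>\<^sub>M P x)"
  using hitting_time_measurable[of z] joint_measurable_law[OF x]
    measurable_cong_sets[OF sets_law[OF x] refl]
  by auto

lemma measurable_shifted:
  "(\<lambda>(t, \<omega>). X (enn2real (hitting_time X z \<omega>) + max 0 t) \<omega>) \<in> borel_measurable (borel \<Otimes>\<^sub>M P x)"
proof -
  note [measurable] = measurable_law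
  have "(\<lambda>p. (\<lambda>(t, \<omega>). X (max 0 t) \<omega>) (enn2real (hitting_time X z (snd p)) + max 0 (fst p), snd p))
      \<in> borel_measurable (borel \<Otimes>\<^sub>M P x)"
    by measurable
  then show ?thesis
    by (simp add: case_prod_beta')
qed

text \<open>An exponential clock of rate \<alpha> rings no earlier than \<open>T\<close> with
  probability \<open>exp (- \<alpha> * T)\<close>. For \<open>T = \<top>\<close> the set is empty
  and both sides vanish.\<close>

lemma discount_layer_cake:
  "(\<integral>\<^sup>+c. ennreal (\<alpha> * exp (- \<alpha> * c)) * indicator {c. 0 \<le> c \<and> T \<le> ennreal c} c \<partial>lborel)
    = (if T = \<top> then 0 else ennreal (exp (- \<alpha> * enn2real T)))"
proof (cases T)
  case (real t)
  then have "{c. 0 \<le> c \<and> T \<le> ennreal c} = {t..}"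
    by (auto simp: ennreal_le_iff2)
  then show ?thesis
    using real nn_integral_exp_tail[OF \<alpha>, of t] by simp
qed (simp add: top_unique)

text \<open>The discount factor is cut into the layers \<open>T \<le> c\<close>; on each layer the
  strong Markov property splits off the law started at \<open>z\<close>, and the layers are then put
  together again.\<close>

lemma expectation_shifted:
  assumes [measurable]: "B \<in> sets borel" and u: "0 \<le> u"
  shows "(\<integral>\<^sup>+\<omega>. indicator B (X (enn2real (hitting_time X z \<omega>) + u) \<omega>) *
      (if hitting_time X z \<omega> = \<top> then 0 else ennreal (exp (- \<alpha> * enn2real (hitting_time X z \<omega>)))) \<partial>P x)
    = ennreal (discounted_hitting P X \<alpha> x z) * emeasure (P z) {\<omega>\<in>space M. X u \<omega> \<in> B}"
proof -
  let ?T = "hitting_time X z"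
  interpret pair_sigma_finite lborel "P x" by unfold_locales
  have [measurable]: "?T \<in> borel_measurable (P x)"
    by (rule measurable_law)
  have [measurable]: "(\<lambda>\<omega>. X (enn2real (?T \<omega>) + u) \<omega>) \<in> borel_measurable (P x)"
    using measurable_Pair2[OF measurable_shifted, of u] u by simp
  \<comment> \<open>A general event \<open>C\<close> is allowed because the formula is used twice:
    for the shifted event, and for the whole space, where it returns the discounted hitting
    expectation.\<close>
  have layer: "(\<integral>\<^sup>+\<omega>. indicator C \<omega> *
        (if ?T \<omega> = \<top> then 0 else ennreal (exp (- \<alpha> * enn2real (?T \<omega>)))) \<partial>P x)
      = (\<integral>\<^sup>+c. ennreal (\<alpha> * exp (- \<alpha> * c)) * indicator {0..} c *
          emeasure (P x) {\<omega>\<in>space M. ?T \<omega> \<le> ennreal c \<and> \<omega> \<in> C} \<partial>lborel)"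
    if [measurable]: "C \<in> sets (P x)" for C
  proof -
    have "(\<integral>\<^sup>+\<omega>. indicator C \<omega> *
        (if ?T \<omega> = \<top> then 0 else ennreal (exp (- \<alpha> * enn2real (?T \<omega>)))) \<partial>P x)
      = (\<integral>\<^sup>+\<omega>. \<integral>\<^sup>+c. indicator C \<omega> * (ennreal (\<alpha> * exp (- \<alpha> * c)) *
          indicator {c. 0 \<le> c \<and> ?T \<omega> \<le> ennreal c} c) \<partial>lborel \<partial>P x)"
      unfolding discount_layer_cake[symmetric]
      by (intro nn_integral_cong nn_integral_cmult[symmetric]) measurable
    also have "\<dots> = (\<integral>\<^sup>+c. \<integral>\<^sup>+\<omega>. indicator C \<omega> * (ennreal (\<alpha> * exp (- \<alpha> * c)) *
          indicator {c. 0 \<le> c \<and> ?T \<omega> \<le> ennreal c} c) \<partial>P x \<partial>lborel)"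
      by (rule Fubini') (simp add: indicator_def case_prod_beta')
    also have "\<dots> = (\<integral>\<^sup>+c. \<integral>\<^sup>+\<omega>. ennreal (\<alpha> * exp (- \<alpha> * c)) * indicator {0..} c *
          indicator {\<omega>\<in>space M. ?T \<omega> \<le> ennreal c \<and> \<omega> \<in> C} \<omega> \<partial>P x \<partial>lborel)"
      by (intro nn_integral_cong) (auto simp: indicator_def space_law[OF x])
    also have "\<dots> = (\<integral>\<^sup>+c. ennreal (\<alpha> * exp (- \<alpha> * c)) * indicator {0..} c *
          emeasure (P x) {\<omega>\<in>space M. ?T \<omega> \<le> ennreal c \<and> \<omega> \<in> C} \<partial>lborel)"
      unfolding space_law[OF x, symmetric]
      by (intro nn_integral_cong nn_integral_cmult_indicator) measurable
    finally show ?thesis .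
  qed
  let ?C = "{\<omega>\<in>space M. X (enn2real (?T \<omega>) + u) \<omega> \<in> B}"
  have C: "?C \<in> sets (P x)"
    unfolding space_law[OF x, symmetric] by measurable
  have "(\<integral>\<^sup>+\<omega>. indicator B (X (enn2real (?T \<omega>) + u) \<omega>) *
      (if ?T \<omega> = \<top> then 0 else ennreal (exp (- \<alpha> * enn2real (?T \<omega>)))) \<partial>P x)
    = (\<integral>\<^sup>+\<omega>. indicator ?C \<omega> *
      (if ?T \<omega> = \<top> then 0 else ennreal (exp (- \<alpha> * enn2real (?T \<omega>)))) \<partial>P x)"
    by (intro nn_integral_cong) (auto simp: indicator_def space_law[OF x])
  also have "\<dots> = (\<integral>\<^sup>+c. ennreal (\<alpha> * exp (- \<alpha> * c)) * indicator {0..} c *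
      emeasure (P x) {\<omega>\<in>space M. ?T \<omega> \<le> ennreal c \<and> \<omega> \<in> ?C} \<partial>lborel)"
    by (rule layer[OF C])
  also have "\<dots> = (\<integral>\<^sup>+c. (ennreal (\<alpha> * exp (- \<alpha> * c)) * indicator {0..} c *
      emeasure (P x) {\<omega>\<in>space M. ?T \<omega> \<le> ennreal c \<and> \<omega> \<in> space (P x)}) *
        emeasure (P z) {\<omega>\<in>space M. X u \<omega> \<in> B} \<partial>lborel)"
  proof (rule nn_integral_cong)
    fix c :: real
    show "ennreal (\<alpha> * exp (- \<alpha> * c)) * indicator {0..} c *
        emeasure (P x) {\<omega>\<in>space M. ?T \<omega> \<le> ennreal c \<and> \<omega> \<in> ?C} =
      ennreal (\<alpha> * exp (- \<alpha> * c)) * indicator {0..} c *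
        emeasure (P x) {\<omega>\<in>space M. ?T \<omega> \<le> ennreal c \<and> \<omega> \<in> space (P x)} *
        emeasure (P z) {\<omega>\<in>space M. X u \<omega> \<in> B}"
      using strong_markov_hitting[OF x z assms(1) u, of c]
      by (cases "0 \<le> c") (simp_all add: space_law[OF x] mult.assoc cong: conj_cong)
  qed
  also have "\<dots> = (\<integral>\<^sup>+c. ennreal (\<alpha> * exp (- \<alpha> * c)) * indicator {0..} c *
      emeasure (P x) {\<omega>\<in>space M. ?T \<omega> \<le> ennreal c \<and> \<omega> \<in> space (P x)} \<partial>lborel) *
        emeasure (P z) {\<omega>\<in>space M. X u \<omega> \<in> B}"
    unfolding space_law[OF x, symmetric]
    by (rule nn_integral_multc) measurable
  also have "(\<integral>\<^sup>+c. ennreal (\<alpha> * exp (- \<alpha> * c)) * indicator {0..} c *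
      emeasure (P x) {\<omega>\<in>space M. ?T \<omega> \<le> ennreal c \<and> \<omega> \<in> space (P x)} \<partial>lborel) =
      ennreal (discounted_hitting P X \<alpha> x z)"
    unfolding ennreal_discounted_hitting[where P=P and x=x and X=X and z=z, OF prob_space_law[OF x] measurable_law(1) \<alpha>]
      layer[OF sets.top, symmetric]
    by (intro nn_integral_cong) simp
  finally show ?thesis .
qed

text \<open>The right-hand side is the expected discounted time spent in \<open>B\<close> from the
  first visit to \<open>z\<close> on. Restarting the clock at that visit extracts the discount
  factor, and \<open>expectation_shifted\<close> evaluates each fixed delay
  \<open>u\<close>.\<close>

lemma potential_after_hitting:
  assumes [measurable]: "B \<in> sets borel"
  shows "ennreal (discounted_hitting P X \<alpha> x z) * potential P X \<alpha> z B =
    (\<integral>\<^sup>+\<omega>. \<integral>\<^sup>+t. ennreal (exp (- \<alpha> * t)) *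
        indicator {t. 0 \<le> t \<and> hitting_time X z \<omega> \<le> ennreal t \<and> X t \<omega> \<in> B} t \<partial>lborel \<partial>P x)"
proof -
  let ?T = "hitting_time X z"
  let ?E = "\<lambda>\<omega>. if ?T \<omega> = \<top> then 0 else ennreal (exp (- \<alpha> * enn2real (?T \<omega>)))"
  interpret pair_sigma_finite lborel "P x" by unfold_locales
  note [measurable] = measurable_law measurable_shifted
  have path: "(\<integral>\<^sup>+t. ennreal (exp (- \<alpha> * t)) *
        indicator {t. 0 \<le> t \<and> ?T \<omega> \<le> ennreal t \<and> X t \<omega> \<in> B} t \<partial>lborel) =
      (\<integral>\<^sup>+u. ennreal (exp (- \<alpha> * u)) * indicator {0..} u *
        (indicator B (X (enn2real (?T \<omega>) + max 0 u) \<omega>) * ?E \<omega>) \<partial>lborel)"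
    if \<omega>: "\<omega> \<in> space (P x)" for \<omega>
  proof (cases "?T \<omega>")
    case (real h)
    have [measurable]: "(\<lambda>t. X (max 0 t) \<omega>) \<in> borel_measurable borel"
      using measurable_Pair1[OF measurable_law(2) \<omega>] by simp
    have "(\<integral>\<^sup>+t. ennreal (exp (- \<alpha> * t)) *
        indicator {t. 0 \<le> t \<and> ?T \<omega> \<le> ennreal t \<and> X t \<omega> \<in> B} t \<partial>lborel) =
      (\<integral>\<^sup>+t. ennreal (exp (- \<alpha> * t)) * indicator {h..} t * indicator B (X (max 0 t) \<omega>) \<partial>lborel)"
      using real by (intro nn_integral_cong) (auto simp: indicator_def max_def ennreal_le_iff2)
    \<comment> \<open>Translation by the hitting time \<open>h\<close>, under which Lebesgue measure
      is invariant.\<close>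
    also have "\<dots> = (\<integral>\<^sup>+u. ennreal (exp (- \<alpha> * (h + u))) * indicator {h..} (h + u) *
        indicator B (X (max 0 (h + u)) \<omega>) \<partial>lborel)"
      by (subst nn_integral_real_affine[where c=1 and t=h]) auto
    also have "\<dots> = (\<integral>\<^sup>+u. ennreal (exp (- \<alpha> * u)) * indicator {0..} u *
        (indicator B (X (enn2real (?T \<omega>) + max 0 u) \<omega>) * ?E \<omega>) \<partial>lborel)"
      using real by (intro nn_integral_cong)
        (auto simp: indicator_def max_def ring_distribs exp_diff exp_minus exp_add
          ennreal_mult[symmetric] field_simps)
    finally show ?thesis .
  qed (simp add: top_unique)
  have "(\<integral>\<^sup>+\<omega>. \<integral>\<^sup>+t. ennreal (exp (- \<alpha> * t)) *
        indicator {t. 0 \<le> t \<and> hitting_time X z \<omega> \<le> ennreal t \<and> X t \<omega> \<in> B} t \<partial>lborel \<partial>P x) =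
      (\<integral>\<^sup>+\<omega>. \<integral>\<^sup>+u. ennreal (exp (- \<alpha> * u)) * indicator {0..} u *
        (indicator B (X (enn2real (?T \<omega>) + max 0 u) \<omega>) * ?E \<omega>) \<partial>lborel \<partial>P x)"
    by (intro nn_integral_cong path)
  also have "\<dots> = (\<integral>\<^sup>+u. \<integral>\<^sup>+\<omega>. ennreal (exp (- \<alpha> * u)) * indicator {0..} u *
        (indicator B (X (enn2real (?T \<omega>) + max 0 u) \<omega>) * ?E \<omega>) \<partial>P x \<partial>lborel)"
    by (rule Fubini') measurable
  also have "\<dots> = (\<integral>\<^sup>+u. ennreal (discounted_hitting P X \<alpha> x z) * (ennreal (exp (- \<alpha> * u)) *
        indicator {0..} u * emeasure (P z) {\<omega>\<in>space (P z). X u \<omega> \<in> B}) \<partial>lborel)"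
  proof (rule nn_integral_cong)
    fix u :: real
    show "(\<integral>\<^sup>+\<omega>. ennreal (exp (- \<alpha> * u)) * indicator {0..} u *
        (indicator B (X (enn2real (?T \<omega>) + max 0 u) \<omega>) * ?E \<omega>) \<partial>P x) =
      ennreal (discounted_hitting P X \<alpha> x z) * (ennreal (exp (- \<alpha> * u)) *
        indicator {0..} u * emeasure (P z) {\<omega>\<in>space (P z). X u \<omega> \<in> B})"
    proof (cases "0 \<le> u")
      case True
      have [measurable]: "(\<lambda>\<omega>. X (enn2real (?T \<omega>) + u) \<omega>) \<in> borel_measurable (P x)"
        using measurable_Pair2[OF measurable_shifted, of u] True by simp
      have "(\<integral>\<^sup>+\<omega>. ennreal (exp (- \<alpha> * u)) *
          (indicator B (X (enn2real (?T \<omega>) + u) \<omega>) * ?E \<omega>) \<partial>P x) =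
        ennreal (exp (- \<alpha> * u)) * (\<integral>\<^sup>+\<omega>. indicator B (X (enn2real (?T \<omega>) + u) \<omega>) * ?E \<omega> \<partial>P x)"
        by (rule nn_integral_cmult) measurable
      then show ?thesis
        using True unfolding expectation_shifted[OF assms True]
        by (simp add: max_def space_law[OF z] mult_ac)
    qed simp
  qed
  also have "\<dots> = ennreal (discounted_hitting P X \<alpha> x z) * potential P X \<alpha> z B"
    unfolding potential_def
  proof (rule nn_integral_cmult)
    interpret Z: prob_space "P z" by (rule prob_space_law[OF z])
    note [measurable] = joint_measurable_law[OF z]
    \<comment> \<open>Joint measurability is available for the clamped time \<open>max 0 u\<close>;
      the indicator of \<open>{0..}\<close> hides the difference.\<close>
    have "(\<lambda>u. ennreal (exp (- \<alpha> * u)) * indicator {0..} u *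
        emeasure (P z) {\<omega>\<in>space (P z). X (max 0 u) \<omega> \<in> B}) \<in> borel_measurable lborel"
      by measurable
    also have "(\<lambda>u. ennreal (exp (- \<alpha> * u)) * indicator {0..} u *
        emeasure (P z) {\<omega>\<in>space (P z). X (max 0 u) \<omega> \<in> B}) =
      (\<lambda>u. ennreal (exp (- \<alpha> * u)) * indicator {0..} u *
        emeasure (P z) {\<omega>\<in>space (P z). X u \<omega> \<in> B})"
      by (auto simp: fun_eq_iff indicator_def max_def)
    finally show "(\<lambda>u. ennreal (exp (- \<alpha> * u)) * indicator {0..} u *
        emeasure (P z) {\<omega>\<in>space (P z). X u \<omega> \<in> B}) \<in> borel_measurable lborel" .
  qed
  finally show ?thesis ..
qed

section \<open>Comparison of potentials through occupation times\<close>

text \<open>Tonelli turns the time integral of probabilities into a mean occupation time, so that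
  potentials can be compared path by path.\<close>

lemma potential_as_occupation:
  assumes [measurable]: "B \<in> sets borel"
  shows "potential P X \<alpha> x B =
    (\<integral>\<^sup>+\<omega>. \<integral>\<^sup>+t. ennreal (exp (- \<alpha> * t)) * indicator {t. 0 \<le> t \<and> X t \<omega> \<in> B} t \<partial>lborel \<partial>P x)"
proof -
  interpret pair_sigma_finite lborel "P x" by unfold_locales
  note [measurable] = measurable_law
  have "potential P X \<alpha> x B = (\<integral>\<^sup>+t. \<integral>\<^sup>+\<omega>. ennreal (exp (- \<alpha> * t)) * indicator {0..} t *
      indicator B (X (max 0 t) \<omega>) \<partial>P x \<partial>lborel)"
    unfolding potential_def
  proof (rule nn_integral_cong)
    fix t :: real
    have [measurable]: "(\<lambda>\<omega>. X (max 0 t) \<omega>) \<in> borel_measurable (P x)"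
      using measurable_Pair2[OF measurable_law(2), of t] by simp
    have "(\<integral>\<^sup>+\<omega>. ennreal (exp (- \<alpha> * t)) * indicator {0..} t * indicator B (X (max 0 t) \<omega>) \<partial>P x) =
      (\<integral>\<^sup>+\<omega>. ennreal (exp (- \<alpha> * t)) * indicator {0..} t *
        indicator {\<omega>\<in>space (P x). X (max 0 t) \<omega> \<in> B} \<omega> \<partial>P x)"
      by (intro nn_integral_cong) (auto simp: indicator_def)
    also have "\<dots> = ennreal (exp (- \<alpha> * t)) * indicator {0..} t *
        emeasure (P x) {\<omega>\<in>space (P x). X (max 0 t) \<omega> \<in> B}"
      by (rule nn_integral_cmult_indicator) measurable
    finally show "ennreal (exp (- \<alpha> * t)) * indicator {0..} t *
        emeasure (P x) {\<omega>\<in>space (P x). X t \<omega> \<in> B} =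
      (\<integral>\<^sup>+\<omega>. ennreal (exp (- \<alpha> * t)) * indicator {0..} t * indicator B (X (max 0 t) \<omega>) \<partial>P x)"
      by (auto simp: indicator_def max_def)
  qed
  also have "\<dots> = (\<integral>\<^sup>+\<omega>. \<integral>\<^sup>+t. ennreal (exp (- \<alpha> * t)) * indicator {0..} t *
      indicator B (X (max 0 t) \<omega>) \<partial>lborel \<partial>P x)"
    by (rule Fubini'[symmetric]) measurable
  also have "\<dots> = (\<integral>\<^sup>+\<omega>. \<integral>\<^sup>+t. ennreal (exp (- \<alpha> * t)) *
      indicator {t. 0 \<le> t \<and> X t \<omega> \<in> B} t \<partial>lborel \<partial>P x)"
    by (intro nn_integral_cong) (auto simp: indicator_def max_def)
  finally show ?thesis .
qed

text \<open>Time spent in \<open>B\<close> after the first visit to \<open>z\<close> is part of all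
  the time spent in \<open>B\<close>.\<close>

lemma potential_hitting_le:
  assumes "B \<in> sets borel"
  shows "ennreal (discounted_hitting P X \<alpha> x z) * potential P X \<alpha> z B \<le> potential P X \<alpha> x B"
  unfolding potential_after_hitting[OF assms] potential_as_occupation[OF assms]
  by (intro nn_integral_mono) (auto simp: indicator_def)

text \<open>By continuity, paths from \<open>x\<close> reach a set lying beyond \<open>z\<close> only through \<open>z\<close>.\<close>

lemma potential_hitting_eq:
  assumes B: "B \<in> sets borel" "B \<subseteq> {z..}" and xz: "x \<le> z"
  shows "potential P X \<alpha> x B = ennreal (discounted_hitting P X \<alpha> x z) * potential P X \<alpha> z B"
  unfolding potential_after_hitting[OF B(1)] potential_as_occupation[OF B(1)]
proof (rule nn_integral_cong_AE)
  have le: "hitting_time X z \<omega> \<le> ennreal t"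
    if "\<omega> \<in> space M" "X 0 \<omega> = x" "0 \<le> t" "X t \<omega> \<in> B" for \<omega> t
  proof -
    have "\<exists>u\<ge>0. u \<le> t \<and> X u \<omega> = z"
      using that B(2) xz by (intro IVT') (auto intro: continuous_on_subset[OF path_continuous])
    then show ?thesis
      using that by (subst hitting_time_le_iff[where X=X, OF path_continuous]) auto
  qed
  show "AE \<omega> in P x. (\<integral>\<^sup>+t. ennreal (exp (- \<alpha> * t)) *
      indicator {t. 0 \<le> t \<and> X t \<omega> \<in> B} t \<partial>lborel) =
    (\<integral>\<^sup>+t. ennreal (exp (- \<alpha> * t)) *
      indicator {t. 0 \<le> t \<and> hitting_time X z \<omega> \<le> ennreal t \<and> X t \<omega> \<in> B} t \<partial>lborel)"
    using AE_start[OF x] AE_space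
    by eventually_elim (auto intro!: nn_integral_cong le simp: indicator_def space_law[OF x])
qed

end

end

section \<open>The Green function\<close>

text \<open>The hypothesis is tested on the set where \<open>g < f\<close>: there the difference is
  positive but its integral is 0, so the set is null. Finiteness of the integral of \<open>f\<close>
  allows the subtraction. This passes from measures to densities.\<close>

lemma AE_le_if_nn_integral_le:
  fixes f g :: "'a \<Rightarrow> ennreal"
  assumes [measurable]: "f \<in> borel_measurable N" "g \<in> borel_measurable N"
    and fin: "(\<integral>\<^sup>+x. f x \<partial>N) < \<top>"
    and le: "\<And>B. B \<in> sets N \<Longrightarrow> (\<integral>\<^sup>+x. f x * indicator B x \<partial>N) \<le> (\<integral>\<^sup>+x. g x * indicator B x \<partial>N)"
  shows "AE x in N. f x \<le> g x"
proof -
  define B where "B = {x\<in>space N. g x < f x}"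
  have [measurable]: "B \<in> sets N" by (simp add: B_def)
  have gf: "g x * indicator B x \<le> f x * indicator B x" for x
    by (auto simp: indicator_def B_def)
  have "(\<integral>\<^sup>+x. g x * indicator B x \<partial>N) \<le> (\<integral>\<^sup>+x. f x \<partial>N)"
    by (intro nn_integral_mono) (auto simp: indicator_def B_def)
  with fin have gfin: "(\<integral>\<^sup>+x. g x * indicator B x \<partial>N) \<noteq> \<infinity>" by auto
  have "(\<integral>\<^sup>+x. f x * indicator B x - g x * indicator B x \<partial>N) =
      (\<integral>\<^sup>+x. f x * indicator B x \<partial>N) - (\<integral>\<^sup>+x. g x * indicator B x \<partial>N)"
    using gf gfin by (intro nn_integral_diff) auto
  also have "\<dots> = 0"
    using le[of B] gfin by (simp add: diff_eq_0_iff_ennreal less_top)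
  finally have "AE x in N. f x * indicator B x - g x * indicator B x = 0"
    by (subst (asm) nn_integral_0_iff_AE) auto
  then show ?thesis
    using AE_space
  proof eventually_elim
    case (elim x)
    show ?case
    proof (rule ccontr)
      assume "\<not> f x \<le> g x"
      with elim have "f x - g x = 0" "g x < f x" by (auto simp: B_def not_le)
      then show False by (auto simp: diff_eq_0_iff_ennreal)
    qed
  qed
qed

text \<open>Countably many compact intervals cover \<open>I\<close>, each of finite mass, and the
  complement of \<open>I\<close> is null. The result permits Tonelli between time and space.\<close>

lemma sigma_finite_speed_measure:
  assumes speed: "speed_measure I P X s m" and I: "is_interval I" "interior I \<noteq> {}"
  shows "sigma_finite_measure m"
proof
  have sets: "sets m = sets borel" and null: "emeasure m (- I) = 0"
    and fin: "\<And>a b. a \<in> I \<Longrightarrow> b \<in> I \<Longrightarrow> a < b \<Longrightarrow> emeasure m {a..b} < \<top>"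
    using speed by (auto simp: speed_measure_def)
  have I_sets: "I \<in> sets borel"
    by (rule real_interval_borel_measurable) fact
  obtain p q where pq: "p \<in> I" "q \<in> I" "p < q"
  proof -
    obtain c e where "0 < e" "cball c e \<subseteq> I"
      using I(2) by (auto simp: mem_interior_cball)
    then have "c \<in> I" "c + e \<in> I" "c < c + e"
      by (auto simp: subset_iff dist_real_def)
    then show thesis by (rule that)
  qed
  \<comment> \<open>Rationals alone do not bracket an endpoint that belongs to \<open>I\<close>,
    hence the two extra sets, each with at most one element.\<close>
  define D where "D = (I \<inter> \<rat>) \<union> {d\<in>I. \<forall>y\<in>I. d \<le> y} \<union> {d\<in>I. \<forall>y\<in>I. y \<le> d}"
  have "{d\<in>I. \<forall>y\<in>I. d \<le> y} \<subseteq> {Inf I}" "{d\<in>I. \<forall>y\<in>I. y \<le> d} \<subseteq> {Sup I}"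
    by (auto intro: cInf_eq_minimum[symmetric] cSup_eq_maximum[symmetric])
  then have "countable {d\<in>I. \<forall>y\<in>I. d \<le> y}" "countable {d\<in>I. \<forall>y\<in>I. y \<le> d}"
    by (auto intro: countable_subset)
  then have D: "countable D"
    by (auto simp: D_def countable_rat intro: countable_Int2)
  have below: "\<exists>a\<in>D. a \<le> x" if x: "x \<in> I" for x
  proof (cases "\<forall>y\<in>I. x \<le> y")
    case False
    then obtain y where y: "y \<in> I" "y < x" by force
    then obtain r where "r \<in> \<rat>" "y < r" "r < x" using Rats_dense_in_real by blast
    moreover then have "r \<in> I" using I(1) x y unfolding is_interval_1 by (meson less_imp_le)
    ultimately show ?thesis by (intro bexI[of _ r]) (auto simp: D_def)
  qed (use x in \<open>auto simp: D_def\<close>)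
  have above: "\<exists>b\<in>D. x \<le> b" if x: "x \<in> I" for x
  proof (cases "\<forall>y\<in>I. y \<le> x")
    case False
    then obtain y where y: "y \<in> I" "x < y" by force
    then obtain r where "r \<in> \<rat>" "x < r" "r < y" using Rats_dense_in_real by blast
    moreover then have "r \<in> I" using I(1) x y unfolding is_interval_1 by (meson less_imp_le)
    ultimately show ?thesis by (intro bexI[of _ r]) (auto simp: D_def)
  qed (use x in \<open>auto simp: D_def\<close>)
  \<comment> \<open>The speed measure is known to be finite on intervals with \<open>a < b\<close>.
    Enlarging by the fixed points \<open>p < q\<close> also settles a single point or an empty
    interval.\<close>
  have Icc: "emeasure m {a..b} \<noteq> \<infinity>" if "a \<in> I" "b \<in> I" for a b
  proof -
    have "emeasure m {a..b} \<le> emeasure m {min a p..max b q}"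
      by (intro emeasure_mono) (auto simp: sets)
    also have "\<dots> < \<top>"
      using that pq by (intro fin) (auto simp: min_def max_def)
    finally show ?thesis by simp
  qed
  show "\<exists>A. countable A \<and> A \<subseteq> sets m \<and> \<Union>A = space m \<and> (\<forall>a\<in>A. emeasure m a \<noteq> \<infinity>)"
  proof (intro exI conjI)
    let ?A = "insert (- I) ((\<lambda>(a, b). {a..b}) ` (D \<times> D))"
    show "countable ?A" using D by auto
    show "?A \<subseteq> sets m" using I_sets by (auto simp: sets)
    have "space m = UNIV" using sets_eq_imp_space_eq[OF sets] by simp
    moreover have "x \<in> \<Union>?A" for x
      using below[of x] above[of x] by (cases "x \<in> I") auto
    ultimately show "\<Union>?A = space m" by auto
    show "\<forall>a\<in>?A. emeasure m a \<noteq> \<infinity>"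
      using Icc null by (auto simp: D_def)
  qed
qed

section \<open>The Green function as density of the potential\<close>

text \<open>An extended-valued Green function: a divergent time integral has the value \<top> here,
  while the Bochner integral in \<open>green_function\<close> then defaults to 0.\<close>

definition green_kernel :: "(real \<Rightarrow> real \<Rightarrow> real \<Rightarrow> real) \<Rightarrow> real \<Rightarrow> real \<Rightarrow> real \<Rightarrow> ennreal" where
  "green_kernel p \<alpha> x y = (\<integral>\<^sup>+t. ennreal (exp (- \<alpha> * t) * p t x y) * indicator {0<..} t \<partial>lborel)"

locale diffusion_density = diffusion I M P X
  for I :: "real set" and M :: "'a measure" and P X +
  fixes s :: "real \<Rightarrow> real" and m :: "real measure"
    and p :: "real \<Rightarrow> real \<Rightarrow> real \<Rightarrow> real" and \<alpha> :: real
  assumes speed: "speed_measure I P X s m"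
    and density: "transition_density I M P X m p"
    and \<alpha>: "0 < \<alpha>"
begin

lemma sets_speed [measurable_cong]: "sets m = sets borel"
  using speed by (simp add: speed_measure_def)

lemma interval_sets [measurable]: "I \<in> sets borel"
  by (rule real_interval_borel_measurable[OF interval])

lemma p_nonneg: "0 < t \<Longrightarrow> x \<in> I \<Longrightarrow> y \<in> I \<Longrightarrow> 0 \<le> p t x y"
  and p_density: "0 < t \<Longrightarrow> x \<in> I \<Longrightarrow> B \<in> sets borel \<Longrightarrow>
    emeasure (P x) {\<omega>\<in>space M. X t \<omega> \<in> B} = (\<integral>\<^sup>+y. ennreal (p t x y) * indicator (B \<inter> I) y \<partial>m)"
  using density by (auto simp: transition_density_def)

lemma p_measurable [measurable (raw)]:
  assumes [measurable]: "f \<in> borel_measurable N" "g \<in> borel_measurable N" "h \<in> borel_measurable N"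
  shows "(\<lambda>w. p (f w) (g w) (h w)) \<in> borel_measurable N"
proof -
  have [measurable]: "(\<lambda>(t, x, y). p t x y) \<in> borel_measurable (borel \<Otimes>\<^sub>M borel \<Otimes>\<^sub>M borel)"
    using density by (simp add: transition_density_def)
  have "(\<lambda>w. (\<lambda>(t, x, y). p t x y) (f w, g w, h w)) \<in> borel_measurable N"
    by measurable
  then show ?thesis by simp
qed

lemma sigma_finite_m: "sigma_finite_measure m"
  using diffusion by (intro sigma_finite_speed_measure[OF speed]) (auto simp: regular_diffusion_def)

lemma green_kernel_measurable [measurable]: "green_kernel p \<alpha> x \<in> borel_measurable m"
  unfolding green_kernel_def by measurable

text \<open>In the divergent case both sides are 0, since \<open>enn2real\<close> sends \<top> to
  0.\<close>

lemma green_function_eq: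
  assumes "x \<in> I" "y \<in> I"
  shows "green_function p \<alpha> x y = enn2real (green_kernel p \<alpha> x y)"
proof -
  have "green_function p \<alpha> x y = enn2real (\<integral>\<^sup>+t. ennreal (indicator {0<..} t *\<^sub>R (exp (- \<alpha> * t) * p t x y)) \<partial>lborel)"
    unfolding green_function_def set_lebesgue_integral_def
    using p_nonneg[OF _ assms] by (intro integral_eq_nn_integral) (auto simp: indicator_def)
  also have "(\<integral>\<^sup>+t. ennreal (indicator {0<..} t *\<^sub>R (exp (- \<alpha> * t) * p t x y)) \<partial>lborel) = green_kernel p \<alpha> x y"
    unfolding green_kernel_def by (intro nn_integral_cong) (auto simp: indicator_def)
  finally show ?thesis .
qed

lemma green_function_nonneg: "x \<in> I \<Longrightarrow> y \<in> I \<Longrightarrow> 0 \<le> green_function p \<alpha> x y"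
  by (simp add: green_function_eq)

text \<open>Tonelli exchanges the time integral of the transition density with the integral against
  \<open>m\<close>.\<close>

lemma potential_eq_green_kernel:
  assumes x: "x \<in> I" and [measurable]: "B \<in> sets borel"
  shows "potential P X \<alpha> x B = (\<integral>\<^sup>+y. green_kernel p \<alpha> x y * indicator (B \<inter> I) y \<partial>m)"
proof -
  interpret m: sigma_finite_measure m by (rule sigma_finite_m)
  interpret pair_sigma_finite lborel m by unfold_locales
  have "potential P X \<alpha> x B = (\<integral>\<^sup>+t. \<integral>\<^sup>+y. ennreal (exp (- \<alpha> * t) * p t x y) * indicator {0<..} t *
      indicator (B \<inter> I) y \<partial>m \<partial>lborel)"
    unfolding potential_def
  proof (rule nn_integral_cong_AE)
    show "AE t in lborel. ennreal (exp (- \<alpha> * t)) * indicator {0..} t *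
        emeasure (P x) {\<omega>\<in>space (P x). X t \<omega> \<in> B} =
      (\<integral>\<^sup>+y. ennreal (exp (- \<alpha> * t) * p t x y) * indicator {0<..} t * indicator (B \<inter> I) y \<partial>m)"
      \<comment> \<open>Time 0, at which the law is not given by a density, is a Lebesgue null
        set.\<close>
      using AE_lborel_singleton[of "0::real"]
    proof eventually_elim
      case (elim t)
      show ?case
      proof (cases "0 < t")
        case True
        have "ennreal (exp (- \<alpha> * t)) * emeasure (P x) {\<omega>\<in>space (P x). X t \<omega> \<in> B} =
            (\<integral>\<^sup>+y. ennreal (exp (- \<alpha> * t)) * (ennreal (p t x y) * indicator (B \<inter> I) y) \<partial>m)"
          unfolding space_law[OF x] p_density[OF True x \<open>B \<in> sets borel\<close>]
          by (rule nn_integral_cmult[symmetric]) measurable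
        also have "\<dots> = (\<integral>\<^sup>+y. ennreal (exp (- \<alpha> * t) * p t x y) * indicator (B \<inter> I) y \<partial>m)"
          using p_nonneg[OF True x]
          by (intro nn_integral_cong) (auto simp: indicator_def ennreal_mult)
        finally show ?thesis using True by simp
      qed (use elim in auto)
    qed
  qed
  also have "\<dots> = (\<integral>\<^sup>+y. \<integral>\<^sup>+t. ennreal (exp (- \<alpha> * t) * p t x y) * indicator {0<..} t *
      indicator (B \<inter> I) y \<partial>lborel \<partial>m)"
    by (rule Fubini'[symmetric]) measurable
  also have "\<dots> = (\<integral>\<^sup>+y. green_kernel p \<alpha> x y * indicator (B \<inter> I) y \<partial>m)"
    unfolding green_kernel_def by (intro nn_integral_cong nn_integral_multc) measurable
  finally show ?thesis .
qed

text \<open>Probabilities are at most 1, so the discounted time bounds the potential by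
  \<open>1 / \<alpha>\<close>.\<close>

lemma potential_finite:
  assumes x: "x \<in> I"
  shows "potential P X \<alpha> x B < \<top>"
proof -
  interpret prob_space "P x" by (rule prob_space_law[OF x])
  have "potential P X \<alpha> x B \<le> (\<integral>\<^sup>+t. ennreal (1 / \<alpha>) * (ennreal (\<alpha> * exp (- \<alpha> * t)) * indicator {0..} t) \<partial>lborel)"
    unfolding potential_def
  proof (rule nn_integral_mono)
    fix t :: real
    have "ennreal (exp (- \<alpha> * t)) * indicator {0..} t * emeasure (P x) {\<omega>\<in>space (P x). X t \<omega> \<in> B} \<le>
        ennreal (exp (- \<alpha> * t)) * indicator {0..} t * 1"
      by (intro mult_left_mono emeasure_le_1) simp
    also have "\<dots> = ennreal (1 / \<alpha>) * (ennreal (\<alpha> * exp (- \<alpha> * t)) * indicator {0..} t)"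
      using \<alpha> by (auto simp: indicator_def ennreal_mult[symmetric])
    finally show "ennreal (exp (- \<alpha> * t)) * indicator {0..} t * emeasure (P x) {\<omega>\<in>space (P x). X t \<omega> \<in> B} \<le>
      ennreal (1 / \<alpha>) * (ennreal (\<alpha> * exp (- \<alpha> * t)) * indicator {0..} t)" .
  qed
  also have "\<dots> = ennreal (1 / \<alpha>) * ennreal (exp (- \<alpha> * 0))"
    unfolding nn_integral_exp_tail[OF \<alpha>, symmetric] by (rule nn_integral_cmult) measurable
  also have "\<dots> < \<top>" by simp
  finally show ?thesis .
qed

text \<open>The potential has finite total mass, so its density is finite almost everywhere. This
  keeps \<open>enn2real\<close> away from its default value at \<top>.\<close>

lemma green_kernel_finite:
  assumes x: "x \<in> I"
  shows "AE y in m. y \<in> I \<longrightarrow> green_kernel p \<alpha> x y < \<top>"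
proof -
  have "AE y in m. green_kernel p \<alpha> x y * indicator (UNIV \<inter> I) y \<noteq> \<infinity>"
    using potential_finite[OF x, of UNIV] potential_eq_green_kernel[OF x, of UNIV]
    by (intro nn_integral_noteq_infinite) auto
  then show ?thesis
    by eventually_elim (auto simp: less_top)
qed

lemma nn_integral_green_kernel:
  assumes x: "x \<in> I" and [measurable]: "B \<in> sets borel" "K \<in> sets borel"
  shows "(\<integral>\<^sup>+y. c * green_kernel p \<alpha> x y * indicator (K \<inter> I) y * indicator B y \<partial>m) =
    c * potential P X \<alpha> x (B \<inter> K)"
proof -
  have "(\<integral>\<^sup>+y. c * green_kernel p \<alpha> x y * indicator (K \<inter> I) y * indicator B y \<partial>m) =
    (\<integral>\<^sup>+y. c * (green_kernel p \<alpha> x y * indicator (B \<inter> K \<inter> I) y) \<partial>m)"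
    by (intro nn_integral_cong) (auto simp: indicator_def)
  also have "\<dots> = c * potential P X \<alpha> x (B \<inter> K)"
    by (subst potential_eq_green_kernel[OF x]) (auto intro!: nn_integral_cmult)
  finally show ?thesis .
qed

text \<open>A comparison of potential measures on subsets of \<open>K\<close> passes to their
  densities. The exceptional null set depends on \<open>x\<close> and \<open>z\<close>, which does
  no harm because the inequality is only used under integrals against \<open>m\<close>.\<close>

lemma green_kernel_le:
  assumes x: "x \<in> I" and z: "z \<in> I" and [measurable]: "K \<in> sets borel" and "c < \<top>" "d < \<top>"
    and le: "\<And>B. B \<in> sets borel \<Longrightarrow> B \<subseteq> K \<Longrightarrow> c * potential P X \<alpha> z B \<le> d * potential P X \<alpha> x B"
  shows "AE y in m. y \<in> K \<inter> I \<longrightarrow> c * green_kernel p \<alpha> z y \<le> d * green_kernel p \<alpha> x y"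
proof -
  have "AE y in m. c * green_kernel p \<alpha> z y * indicator (K \<inter> I) y \<le>
      d * green_kernel p \<alpha> x y * indicator (K \<inter> I) y"
  proof (rule AE_le_if_nn_integral_le)
    show "(\<integral>\<^sup>+y. c * green_kernel p \<alpha> z y * indicator (K \<inter> I) y \<partial>m) < \<top>"
      using nn_integral_green_kernel[OF z, of UNIV K c] potential_finite[OF z, of K] \<open>c < \<top>\<close>
      by (simp add: ennreal_mult_less_top)
    show "(\<integral>\<^sup>+y. c * green_kernel p \<alpha> z y * indicator (K \<inter> I) y * indicator B y \<partial>m)
        \<le> (\<integral>\<^sup>+y. d * green_kernel p \<alpha> x y * indicator (K \<inter> I) y * indicator B y \<partial>m)"
      if "B \<in> sets m" for B
      using that le[of "B \<inter> K"] by (simp add: nn_integral_green_kernel x z sets_speed)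
  qed measurable
  then show ?thesis
    by eventually_elim auto
qed

lemma discounted_hitting_nonneg: "0 \<le> discounted_hitting P X \<alpha> x z"
  unfolding discounted_hitting_def by (rule Bochner_Integration.integral_nonneg) simp

text \<open>The density form of \<open>potential_hitting_le\<close>.\<close>

lemma green_function_hitting_le:
  assumes x: "x \<in> I" and z: "z \<in> I"
  shows "AE y in m. y \<in> I \<longrightarrow>
    discounted_hitting P X \<alpha> x z * green_function p \<alpha> z y \<le> green_function p \<alpha> x y"
proof -
  let ?d = "discounted_hitting P X \<alpha> x z"
  have "AE y in m. y \<in> UNIV \<inter> I \<longrightarrow> ennreal ?d * green_kernel p \<alpha> z y \<le> 1 * green_kernel p \<alpha> x y"
    by (rule green_kernel_le[OF x z]) (auto intro: potential_hitting_le[OF \<alpha> x z])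
  with green_kernel_finite[OF x] show ?thesis
  proof eventually_elim
    case (elim y)
    show ?case
    proof
      assume y: "y \<in> I"
      then have "enn2real (ennreal ?d * green_kernel p \<alpha> z y) \<le> enn2real (green_kernel p \<alpha> x y)"
        using elim by (intro enn2real_mono) auto
      then show "?d * green_function p \<alpha> z y \<le> green_function p \<alpha> x y"
        using x y z by (simp add: green_function_eq enn2real_mult discounted_hitting_nonneg)
    qed
  qed
qed

text \<open>One inequality is \<open>green_function_hitting_le\<close>; the other is the density
  form of \<open>potential_hitting_eq\<close> on the sets beyond \<open>z\<close>.\<close>

lemma green_function_hitting_eq:
  assumes x: "x \<in> I" and z: "z \<in> I" and xz: "x \<le> z"
  shows "AE y in m. y \<in> I \<and> z < y \<longrightarrow>
    green_function p \<alpha> x y = discounted_hitting P X \<alpha> x z * green_function p \<alpha> z y"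
proof -
  let ?d = "discounted_hitting P X \<alpha> x z"
  have "AE y in m. y \<in> {z<..} \<inter> I \<longrightarrow> 1 * green_kernel p \<alpha> x y \<le> ennreal ?d * green_kernel p \<alpha> z y"
  proof (rule green_kernel_le[OF z x])
    fix B :: "real set" assume B: "B \<in> sets borel" "B \<subseteq> {z<..}"
    then have "B \<subseteq> {z..}" by auto
    with B show "1 * potential P X \<alpha> x B \<le> ennreal ?d * potential P X \<alpha> z B"
      by (simp add: potential_hitting_eq[OF \<alpha> x z _ _ xz])
  qed auto
  with green_kernel_finite[OF z] green_function_hitting_le[OF x z] show ?thesis
  proof eventually_elim
    case (elim y)
    show ?case
    proof
      assume y: "y \<in> I \<and> z < y"
      then have "enn2real (green_kernel p \<alpha> x y) \<le> enn2real (ennreal ?d * green_kernel p \<alpha> z y)"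
        using elim by (intro enn2real_mono) (auto simp: ennreal_mult_less_top)
      then show "green_function p \<alpha> x y = ?d * green_function p \<alpha> z y"
        using x y z elim by (simp add: green_function_eq enn2real_mult discounted_hitting_nonneg)
    qed
  qed
qed

end

section \<open>Scale derivatives\<close>

text \<open>The last point at which \<open>f\<close> is at least \<open>f u\<close> cannot lie
  before \<open>v\<close>, because \<open>f\<close> does not fall immediately to the right of
  it.\<close>

lemma right_increasing_imp_le:
  fixes f :: "real \<Rightarrow> real"
  assumes le: "u \<le> v" and cont: "continuous_on {u..v} f"
    and inc: "\<And>x. u \<le> x \<Longrightarrow> x < v \<Longrightarrow> \<forall>\<^sub>F y in at_right x. f x \<le> f y"
  shows "f u \<le> f v"
proof -
  define S where "S = {x\<in>{u..v}. f u \<le> f x}"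
  have "closed S"
    using continuous_closed_preimage[OF cont closed_atLeastAtMost, of "{f u..}"]
    by (simp add: S_def vimage_def Int_def)
  moreover have "S \<noteq> {}" "bdd_above S"
    using le by (auto simp: S_def bdd_above_def)
  ultimately have Sup: "Sup S \<in> S"
    by (intro closed_contains_Sup)
  have "\<not> Sup S < v"
  proof
    assume less: "Sup S < v"
    then have "\<forall>\<^sub>F y in at_right (Sup S). f (Sup S) \<le> f y \<and> y < v \<and> Sup S < y"
      using inc[of "Sup S"] Sup eventually_at_right_real[OF less]
      by (auto simp: S_def eventually_conj_iff elim: eventually_mono)
    then obtain y where "f (Sup S) \<le> f y" "y < v" "Sup S < y"
      using eventually_happens'[OF trivial_limit_at_right_real] by blast
    moreover then have "y \<in> S"
      using Sup by (auto simp: S_def)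
    ultimately show False
      using cSup_upper[OF _ \<open>bdd_above S\<close>, of y] by simp
  qed
  with Sup have "Sup S = v" by (auto simp: S_def)
  with Sup show ?thesis by (auto simp: S_def)
qed

text \<open>If the mean slope were below \<eta>, any \<open>c\<close> strictly between the two would
  make \<open>h - c * s\<close> nondecreasing immediately to the right of each point, hence
  \<open>h u - c * s u \<le> h v - c * s v\<close>, so the mean slope would be at least
  \<open>c\<close>.\<close>

lemma scale_deriv_lower_bound_closed:
  fixes s h :: "real \<Rightarrow> real"
  assumes less: "u < v" and s: "continuous_on {u..v} s" "strict_mono_on {u..v} s"
    and h: "continuous_on {u..v} h"
    and deriv: "\<And>x. u \<le> x \<Longrightarrow> x < v \<Longrightarrow> \<exists>d\<ge>\<eta>. has_right_scale_deriv s h x d"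
  shows "\<eta> * (s v - s u) \<le> h v - h u"
proof (rule ccontr)
  have suv: "s u < s v"
    using s(2) less by (auto simp: strict_mono_on_def)
  assume "\<not> ?thesis"
  then have "(h v - h u) / (s v - s u) < \<eta>"
    using suv by (simp add: field_simps)
  then obtain c where c: "(h v - h u) / (s v - s u) < c" "c < \<eta>"
    using dense by blast
  have "h u - c * s u \<le> h v - c * s v"
  proof (rule right_increasing_imp_le[where f="\<lambda>x. h x - c * s x"])
    fix x assume x: "u \<le> x" "x < v"
    then obtain d where d: "d \<ge> \<eta>" "has_right_scale_deriv s h x d"
      using deriv by blast
    then have "\<forall>\<^sub>F y in at_right x. c < scale_quotient s h x y"
      using c unfolding has_right_scale_deriv_def by (auto intro: order_tendstoD(1))
    with eventually_at_right_real[OF x(2)]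
    show "\<forall>\<^sub>F y in at_right x. h x - c * s x \<le> h y - c * s y"
    proof eventually_elim
      fix y assume y: "y \<in> {x<..<v}" and "c < scale_quotient s h x y"
      moreover have "s x < s y"
        using s(2) x y by (auto simp: strict_mono_on_def)
      ultimately show "h x - c * s x \<le> h y - c * s y"
        by (simp add: field_simps)
    qed
  qed (use less in \<open>auto intro!: continuous_intros s h\<close>)
  then have "c * (s v - s u) \<le> h v - h u"
    by (simp add: algebra_simps)
  with c suv show False
    by (simp add: field_simps)
qed

text \<open>The closed version on \<open>{x..v}\<close>, with \<open>x\<close> decreasing to
  \<open>u\<close>. Leaving out the endpoint allows the derivative at \<open>u\<close> itself to be
  estimated from those to its right.\<close>

lemma scale_deriv_lower_bound:
  fixes s h :: "real \<Rightarrow> real"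
  assumes less: "u < v" and s: "continuous_on {u..v} s" "strict_mono_on {u..v} s"
    and h: "continuous_on {u..v} h"
    and deriv: "\<And>x. u < x \<Longrightarrow> x < v \<Longrightarrow> \<exists>d\<ge>\<eta>. has_right_scale_deriv s h x d"
  shows "\<eta> * (s v - s u) \<le> h v - h u"
proof (rule tendsto_le[OF trivial_limit_at_right_real])
  have at: "at_right u = at u within {u..v}"
    using less by (simp add: at_within_Icc_at_right)
  have lims: "(s \<longlongrightarrow> s u) (at_right u)" "(h \<longlongrightarrow> h u) (at_right u)"
    using s(1) h less unfolding at by (auto simp: continuous_on_def)
  show "((\<lambda>x. h v - h x) \<longlongrightarrow> h v - h u) (at_right u)"
    "((\<lambda>x. \<eta> * (s v - s x)) \<longlongrightarrow> \<eta> * (s v - s u)) (at_right u)"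
    by (intro tendsto_intros lims)+
  show "\<forall>\<^sub>F x in at_right u. \<eta> * (s v - s x) \<le> h v - h x"
    using eventually_at_right_real[OF less]
  proof eventually_elim
    case (elim x)
    then have "continuous_on {x..v} s" "strict_mono_on {x..v} s" "continuous_on {x..v} h"
      using s h by (auto elim!: continuous_on_subset simp: strict_mono_on_def)
    with elim show ?case
      by (intro scale_deriv_lower_bound_closed deriv) auto
  qed
qed

lemma has_right_scale_deriv_the:
  "has_right_scale_deriv s u x d \<Longrightarrow> right_scale_deriv s u x = d"
  unfolding right_scale_deriv_def has_right_scale_deriv_def
  by (rule the_equality) (auto intro: tendsto_unique[OF trivial_limit_at_right_real])

section \<open>Positivity of a scale derivative and the derivative of \<phi> with respect to
  \<psi>\<close>

text \<open>Strict monotonicity by itself would allow a zero derivative. The positive Feller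
  derivative makes right derivatives before \<open>x\<close> smaller than those after
  \<open>x\<close>; some derivative before \<open>x\<close> is positive because \<open>u\<close>
  increases there, and it bounds the one at \<open>x\<close> from below.\<close>

lemma right_scale_deriv_pos:
  fixes s u :: "real \<Rightarrow> real"
  assumes x: "p < x" "x < q"
    and s: "continuous_on {p..q} s" "strict_mono_on {p..q} s"
    and u: "continuous_on {p..q} u" "strict_mono_on {p..q} u"
    and feller: "has_feller_deriv_interior s m u x c" and c: "0 < c"
  shows "\<exists>d>0. has_right_scale_deriv s u x d"
proof -
  define f where "f = right_scale_deriv s u"
  have "\<forall>\<^sub>F y in nhds x. has_right_scale_deriv s u y (f y)"
    using feller unfolding has_feller_deriv_interior_def f_def
    by (auto elim!: eventually_mono dest: has_right_scale_deriv_the)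
  then have ev: "\<forall>\<^sub>F y in at x. has_right_scale_deriv s u y (f y)"
    and fx: "has_right_scale_deriv s u x (f x)"
    by (auto simp: eventually_nhds_conv_at)
  from ev have evl: "\<forall>\<^sub>F y in at_left x. has_right_scale_deriv s u y (f y)"
    and evr: "\<forall>\<^sub>F y in at_right x. has_right_scale_deriv s u y (f y)"
    by (auto simp: eventually_at_split)
  have "\<forall>\<^sub>F (a, b) in at_left x \<times>\<^sub>F at_right x. 0 < (f b - f a) / measure m {a<..b}"
    using order_tendstoD(1)[of _ c _ 0] feller c
    unfolding has_feller_deriv_interior_def f_def by (force simp: case_prod_beta')
  \<comment> \<open>The denominator is nonnegative and division by 0 gives 0, so a positive quotient
    forces a positive increment.\<close>
  then have "\<forall>\<^sub>F (a, b) in at_left x \<times>\<^sub>F at_right x. f a < f b"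
    by (rule eventually_mono) (auto simp: zero_less_divide_iff not_less[symmetric])
  \<comment> \<open>The product filter separates the two sides: the choice of \<open>a\<close> puts
    no constraint on the choice of \<open>b\<close>.\<close>
  then obtain L R where L: "eventually L (at_left x)" and R: "eventually R (at_right x)"
    and LR: "\<And>a b. L a \<Longrightarrow> R b \<Longrightarrow> f a < f b"
    by (auto simp: eventually_prod_filter)
  obtain a' where a': "a' < x"
    "\<And>y. a' < y \<Longrightarrow> y < x \<Longrightarrow> L y \<and> has_right_scale_deriv s u y (f y)"
    using eventually_conj[OF L evl] unfolding eventually_at_left_field by blast
  define a where "a = max a' ((p + x) / 2)"
  have a: "p < a" "a < x"
    using a' x by (auto simp: a_def less_max_iff_disj)
  have L': "L y \<and> has_right_scale_deriv s u y (f y)" if "a < y" "y < x" for y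
    using a' x that by (auto simp: a_def)
  obtain b' where b': "x < b'"
    "\<And>y. x < y \<Longrightarrow> y < b' \<Longrightarrow> R y \<and> has_right_scale_deriv s u y (f y)"
    using eventually_conj[OF R evr] unfolding eventually_at_right_field by blast
  define b where "b = min b' ((x + q) / 2)"
  have b: "x < b" "b < q"
    using b' x by (auto simp: b_def min_less_iff_disj)
  have R': "R y \<and> has_right_scale_deriv s u y (f y)" if "x < y" "y < b" for y
    using b' x that by (auto simp: b_def)
  have sub: "continuous_on {y..z} s" "strict_mono_on {y..z} s"
    "continuous_on {y..z} u" if "p \<le> y" "z \<le> q" for y z
    using s u that by (auto elim!: continuous_on_subset simp: strict_mono_on_def)
  \<comment> \<open>Otherwise \<open>- u\<close> would have nonnegative right derivatives between
    \<open>a\<close> and the midpoint of \<open>a\<close> and \<open>x\<close>, against the strict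
    increase of \<open>u\<close>.\<close>
  have "\<exists>y. a < y \<and> y < x \<and> 0 < f y"
  proof (rule ccontr)
    assume "\<not> ?thesis"
    then have neg: "f y \<le> 0" if "a < y" "y < x" for y
      using that by force
    have "0 * (s ((a + x) / 2) - s a) \<le> - u ((a + x) / 2) - (- u a)"
    proof (rule scale_deriv_lower_bound)
      fix y assume y: "a < y" "y < (a + x) / 2"
      then have "y < x" by simp
      then have "has_right_scale_deriv s (\<lambda>x. - u x) y (- f y)"
        using L'[OF y(1)] tendsto_minus[of "scale_quotient s u y" "f y"]
        by (simp add: has_right_scale_deriv_def minus_divide_left)
      then show "\<exists>d\<ge>0. has_right_scale_deriv s (\<lambda>x. - u x) y d"
        using neg[OF y(1) \<open>y < x\<close>] by (intro exI[of _ "- f y"]) auto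
    qed (use a x in \<open>auto intro!: sub continuous_intros\<close>)
    moreover have "u a < u ((a + x) / 2)"
      using a x by (intro strict_mono_onD[OF u(2)]) auto
    ultimately show False by simp
  qed
  then obtain y where y: "a < y" "y < x" "0 < f y" by auto
  \<comment> \<open>All derivatives in \<open>(x, z)\<close> exceed \<open>f y\<close>, so the mean
    value inequality bounds the scale quotient at \<open>x\<close>, and with it the limit
    \<open>f x\<close>.\<close>
  have lower: "f y * (s z - s x) \<le> u z - u x" if z: "x < z" "z < b" for z
  proof (rule scale_deriv_lower_bound[OF z(1)])
    fix t assume "x < t" "t < z"
    then show "\<exists>d\<ge>f y. has_right_scale_deriv s u t d"
      using R'[of t] LR[of y t] L'[of y] y z by (intro exI[of _ "f t"]) auto
  qed (use x z b in \<open>auto intro!: sub\<close>)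
  have "f y \<le> f x"
  proof (rule tendsto_lowerbound)
    show "(scale_quotient s u x \<longlongrightarrow> f x) (at_right x)"
      using fx by (simp add: has_right_scale_deriv_def)
    show "\<forall>\<^sub>F z in at_right x. f y \<le> scale_quotient s u x z"
      using eventually_at_right_real[OF b(1)]
    proof eventually_elim
      case (elim z)
      then have "s x < s z"
        using x b by (intro strict_mono_onD[OF s(2)]) auto
      with lower[of z] elim show ?case by (simp add: field_simps)
    qed
  qed simp
  with y fx show ?thesis by (intro exI[of _ "f x"]) auto
qed

text \<open>The increments of \<open>s\<close> cancel in the ratio of the two scale
  quotients.\<close>

lemma tendsto_quotient_of_scale_derivs:
  fixes s u v :: "real \<Rightarrow> real"
  assumes x: "x < q" and s: "strict_mono_on {x..q} s"
    and "has_right_scale_deriv s u x d" "has_right_scale_deriv s v x e" "e \<noteq> 0"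
  shows "((\<lambda>y. (u y - u x) / (v y - v x)) \<longlongrightarrow> d / e) (at_right x)"
proof (rule Lim_transform_eventually)
  show "((\<lambda>y. scale_quotient s u x y / scale_quotient s v x y) \<longlongrightarrow> d / e) (at_right x)"
    using assms by (intro tendsto_intros) (auto simp: has_right_scale_deriv_def)
  show "\<forall>\<^sub>F y in at_right x.
      scale_quotient s u x y / scale_quotient s v x y = (u y - u x) / (v y - v x)"
    using eventually_at_right_real[OF x]
  proof eventually_elim
    case (elim y)
    then have "s x < s y" by (intro strict_mono_onD[OF s]) auto
    then show ?case by simp
  qed
qed

section \<open>Differentiability\<close>

text \<open>Dominated convergence: every \<open>y > a\<close> leaves \<open>{a<..b}\<close> once
  \<open>b < y\<close>. The interval excludes \<open>a\<close>, where an atom of the measure could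
  leave a nonzero limit.\<close>

lemma tendsto_integral_at_right:
  fixes f :: "real \<Rightarrow> real"
  assumes f: "integrable N f" and N: "sets N = sets borel"
  shows "((\<lambda>b. LINT y|N. indicator {a<..b} y * f y) \<longlongrightarrow> 0) (at_right a)"
proof (rule tendsto_at_right_sequentially[of a "a + 1"])
  fix S :: "nat \<Rightarrow> real"
  assume S: "\<And>n. a < S n" "S \<longlonglongrightarrow> a"
  have "(\<lambda>n. LINT y|N. indicator {a<..S n} y * f y) \<longlonglongrightarrow> (LINT y|N. 0)"
  proof (rule integral_dominated_convergence[where w="\<lambda>y. norm (f y)"])
    show "AE y in N. (\<lambda>n. indicator {a<..S n} y * f y) \<longlonglongrightarrow> 0"
    proof (rule AE_I2)
      fix y
      have "\<forall>\<^sub>F n in sequentially. indicator {a<..S n} y * f y = 0"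
      proof (cases "a < y")
        case True
        then show ?thesis
          by (intro eventually_mono[OF order_tendstoD(2)[OF S(2), of y]]) (auto simp: indicator_def)
      qed simp
      then show "(\<lambda>n. indicator {a<..S n} y * f y) \<longlonglongrightarrow> 0"
        by (rule tendsto_eventually)
    qed
    have [measurable]: "f \<in> borel_measurable N" using f by simp
    have [measurable]: "{a<..S n} \<in> sets N" for n by (simp add: N)
    show "(\<lambda>y. indicator {a<..S n} y * f y) \<in> borel_measurable N" for n by measurable
    show "integrable N (\<lambda>y. norm (f y))" using f by simp
    show "AE y in N. norm (indicator {a<..S n} y * f y) \<le> norm (f y)" for n
      by (auto simp: indicator_def)
  qed simp
  then show "(\<lambda>n. LINT y|N. indicator {a<..S n} y * f y) \<longlonglongrightarrow> 0" by simp
qed simp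

context diffusion_density
begin

section \<open>Functions with a Green integral representation above the level
  \<open>a\<close>\<close>

context
  fixes h \<phi> \<psi> V :: "real \<Rightarrow> real" and a :: real
  assumes a: "a \<in> I"
    and pos: "\<And>x. x \<in> I \<Longrightarrow> 0 < \<phi> x" "\<And>x. x \<in> I \<Longrightarrow> 0 < \<psi> x"
    and hit: "\<And>x z. x \<in> I \<Longrightarrow> z \<in> I \<Longrightarrow> x \<le> z \<Longrightarrow> discounted_hitting P X \<alpha> x z = \<psi> x / \<psi> z"
      "\<And>x z. x \<in> I \<Longrightarrow> z \<in> I \<Longrightarrow> z \<le> x \<Longrightarrow> discounted_hitting P X \<alpha> x z = \<phi> x / \<phi> z"
    and int: "\<And>x. x \<in> I \<Longrightarrow> set_integrable m {y\<in>I. a < y} (\<lambda>y. green_function p \<alpha> x y * h y)"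
    and V: "\<And>x. x \<in> I \<Longrightarrow> V x = (LINT y:{y\<in>I. a < y}|m. green_function p \<alpha> x y * h y)"
begin

text \<open>The level \<open>a\<close> separates \<open>x\<close> from every \<open>y\<close> in the
  integration set, so the hitting factor comes out of the integral.\<close>

lemma value_left:
  assumes x: "x \<in> I" "x \<le> a"
  shows "V x = \<psi> x / \<psi> a * V a"
proof -
  have "V x = (LINT y:{y\<in>I. a < y}|m. \<psi> x / \<psi> a * (green_function p \<alpha> a y * h y))"
    unfolding V[OF x(1)] set_lebesgue_integral_def
  proof (rule integral_cong_AE)
    show "AE y in m. indicator {y\<in>I. a < y} y *\<^sub>R (green_function p \<alpha> x y * h y) =
        indicator {y\<in>I. a < y} y *\<^sub>R (\<psi> x / \<psi> a * (green_function p \<alpha> a y * h y))"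
      using green_function_hitting_eq[OF x(1) a x(2)]
      by eventually_elim (auto simp: hit x a indicator_def)
    have "set_integrable m {y\<in>I. a < y} (\<lambda>y. \<psi> x / \<psi> a * (green_function p \<alpha> a y * h y))"
      by (intro set_integrable_mult_right int a)
    then show "(\<lambda>y. indicator {y\<in>I. a < y} y *\<^sub>R (\<psi> x / \<psi> a * (green_function p \<alpha> a y * h y)))
        \<in> borel_measurable m"
      by (simp add: set_integrable_def)
  qed (use int[OF x(1)] in \<open>simp add: set_integrable_def\<close>)
  then show ?thesis by (simp add: V[OF a])
qed

text \<open>Up to the factor \<open>\<psi> b / \<psi> a\<close>, the Green functions with poles \<open>a\<close> and \<open>b\<close> agree
  beyond \<open>b\<close>, so only \<open>(a, b]\<close> contributes.\<close>

lemma value_right_bound: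
  assumes b: "b \<in> I" "a < b"
  shows "\<bar>V b - \<psi> b / \<psi> a * V a\<bar> \<le> (\<psi> b / \<psi> a - \<phi> b / \<phi> a) *
    (LINT y|m. indicator {a<..b} y * \<bar>indicator {y\<in>I. a < y} y * (green_function p \<alpha> a y * h y)\<bar>)"
proof -
  define k where "k x y = indicator {y\<in>I. a < y} y * (green_function p \<alpha> x y * h y)" for x y
  define C where "C = \<psi> b / \<psi> a - \<phi> b / \<phi> a"
  have k: "integrable m (k x)" and Vk: "V x = (LINT y|m. k x y)" if "x \<in> I" for x
    using int[OF that] V[OF that]
    by (simp_all add: k_def[abs_def] set_integrable_def set_lebesgue_integral_def)
  have J: "integrable m (\<lambda>y. C * (indicator {a<..b} y * \<bar>k a y\<bar>))"
    using integrable_mult_indicator[of "{a<..b}" m "\<lambda>y. \<bar>k a y\<bar>"] k[OF a]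
    by (intro integrable_mult_right) (auto simp: sets_speed)
  have "V b - \<psi> b / \<psi> a * V a = (LINT y|m. k b y - \<psi> b / \<psi> a * k a y)"
    using k[OF a] k[OF b(1)] by (simp add: Vk a b)
  also have "\<bar>\<dots>\<bar> \<le> (LINT y|m. \<bar>k b y - \<psi> b / \<psi> a * k a y\<bar>)"
    by (rule integral_abs_bound)
  also have "\<dots> \<le> (LINT y|m. C * (indicator {a<..b} y * \<bar>k a y\<bar>))"
  proof (rule integral_mono_AE)
    show "integrable m (\<lambda>y. \<bar>k b y - \<psi> b / \<psi> a * k a y\<bar>)"
      using k[OF a] k[OF b(1)] by simp
    show "AE y in m. \<bar>k b y - \<psi> b / \<psi> a * k a y\<bar> \<le> C * (indicator {a<..b} y * \<bar>k a y\<bar>)"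
      using green_function_hitting_eq[OF a b(1) less_imp_le[OF b(2)]]
        green_function_hitting_le[OF a b(1)] green_function_hitting_le[OF b(1) a]
    proof eventually_elim
      case (elim y)
      let ?Ga = "green_function p \<alpha> a y" and ?Gb = "green_function p \<alpha> b y"
      have ab: "0 < \<psi> a" "0 < \<psi> b" "0 < \<phi> a"
        using pos a b by auto
      consider "y \<in> I" "b < y" | "y \<in> I" "a < y" "y \<le> b" | "y \<notin> I \<or> y \<le> a" by force
      then show ?case
      proof cases
        case 1
        then have "?Gb = \<psi> b / \<psi> a * ?Ga"
          using elim(1) ab by (simp add: hit a b less_imp_le)
        with 1 show ?thesis by (simp add: k_def)
      next
        case 2
        \<comment> \<open>Hitting \<open>b\<close> from \<open>a\<close> and \<open>a\<close> from
          \<open>b\<close> confine \<open>?Gb\<close> between \<phi>- and \<psi>-multiples of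
          \<open>?Ga\<close>, an interval of length \<open>C * ?Ga\<close> with upper end
          \<open>\<psi> b / \<psi> a * ?Ga\<close>.\<close>
        have "\<psi> a / \<psi> b * ?Gb \<le> ?Ga" "\<phi> b / \<phi> a * ?Ga \<le> ?Gb"
          using elim 2 by (simp_all add: hit a b less_imp_le)
        then have "\<bar>?Gb - \<psi> b / \<psi> a * ?Ga\<bar> \<le> C * ?Ga"
          using ab by (simp add: C_def field_simps)
        then have "\<bar>?Gb - \<psi> b / \<psi> a * ?Ga\<bar> * \<bar>h y\<bar> \<le> C * ?Ga * \<bar>h y\<bar>"
          by (rule mult_right_mono) simp
        with 2 show ?thesis
          using green_function_nonneg[OF a 2(1)]
          by (simp add: k_def abs_mult[symmetric] left_diff_distrib mult.assoc) (simp add: abs_mult)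
      qed (auto simp: k_def)
    qed
  qed (rule J)
  finally show ?thesis
    by (simp add: C_def k_def)
qed

text \<open>On the left the difference quotient is constant. On the right its error is a convergent
  factor times an integral that tends to 0.\<close>

lemma differentiable_value:
  assumes nbhd: "a \<in> interior I"
    and \<psi>: "strict_mono_on I \<psi>"
    and ratio: "((\<lambda>x. (\<phi> x - \<phi> a) / (\<psi> x - \<psi> a)) \<longlongrightarrow> r) (at_right a)"
  shows "((\<lambda>x. (V x - V a) / (\<psi> x - \<psi> a)) \<longlongrightarrow> V a / \<psi> a) (at a)"
proof (rule filterlim_split_at)
  have pa: "0 < \<psi> a" "0 < \<phi> a" using pos a by auto
  have "\<forall>\<^sub>F x in at a. x \<in> I"
    using nbhd by (metis eventually_at_in_open' interior_subset open_interior subsetD eventually_mono)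
  then have evl: "\<forall>\<^sub>F x in at_left a. x \<in> I" and evr: "\<forall>\<^sub>F x in at_right a. x \<in> I"
    by (auto simp: eventually_at_split)
  have "\<forall>\<^sub>F x in at_left a. V a / \<psi> a = (V x - V a) / (\<psi> x - \<psi> a)"
    using evl eventually_at_left_real[of "a - 1" a, simplified]
  proof eventually_elim
    case (elim x)
    then have "\<psi> x < \<psi> a" using a by (intro strict_mono_onD[OF \<psi>]) auto
    then show ?case
      using pa elim by (simp add: value_left field_simps)
  qed
  then show "((\<lambda>x. (V x - V a) / (\<psi> x - \<psi> a)) \<longlongrightarrow> V a / \<psi> a) (at_left a)"
    by (rule Lim_transform_eventually[OF tendsto_const])
  define J where "J b = (LINT y|m. indicator {a<..b} y *
      \<bar>indicator {y\<in>I. a < y} y * (green_function p \<alpha> a y * h y)\<bar>)" for b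
  have J: "(J \<longlongrightarrow> 0) (at_right a)"
    unfolding J_def[abs_def]
    using int[OF a] by (intro tendsto_integral_at_right sets_speed) (simp add: set_integrable_def)
  have "((\<lambda>x. (V x - V a) / (\<psi> x - \<psi> a) - V a / \<psi> a) \<longlongrightarrow> 0) (at_right a)"
  proof (rule Lim_null_comparison)
    show "\<forall>\<^sub>F x in at_right a. norm ((V x - V a) / (\<psi> x - \<psi> a) - V a / \<psi> a) \<le>
        (1 / \<psi> a - (\<phi> x - \<phi> a) / (\<psi> x - \<psi> a) / \<phi> a) * J x"
      using evr eventually_at_right_real[of a "a + 1", simplified]
    proof eventually_elim
      case (elim x)
      then have x: "x \<in> I" "a < x" by auto
      then have less: "\<psi> a < \<psi> x" using a by (intro strict_mono_onD[OF \<psi>]) auto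
      have "(V x - V a) / (\<psi> x - \<psi> a) - V a / \<psi> a = (V x - \<psi> x / \<psi> a * V a) / (\<psi> x - \<psi> a)"
        using less pa by (simp add: field_simps)
      then have "norm ((V x - V a) / (\<psi> x - \<psi> a) - V a / \<psi> a) =
          \<bar>V x - \<psi> x / \<psi> a * V a\<bar> / (\<psi> x - \<psi> a)"
        using less by (simp add: abs_divide)
      also have "\<dots> \<le> (\<psi> x / \<psi> a - \<phi> x / \<phi> a) * J x / (\<psi> x - \<psi> a)"
        using value_right_bound[OF x] less by (intro divide_right_mono) (auto simp: J_def)
      also have "\<dots> = (\<psi> x / \<psi> a - \<phi> x / \<phi> a) / (\<psi> x - \<psi> a) * J x"
        by simp
      \<comment> \<open>The bracket vanishes at \<open>x = a\<close>, so division by the increment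
        of \<psi> leaves only the difference quotient of \<phi> against \<psi>, which converges by
        \<open>ratio\<close>.\<close>
      also have "(\<psi> x / \<psi> a - \<phi> x / \<phi> a) / (\<psi> x - \<psi> a) =
          1 / \<psi> a - (\<phi> x - \<phi> a) / (\<psi> x - \<psi> a) / \<phi> a"
        using less pa by (simp add: field_simps)
      finally show ?case .
    qed
    have "((\<lambda>x. (1 / \<psi> a - (\<phi> x - \<phi> a) / (\<psi> x - \<psi> a) / \<phi> a) * J x) \<longlongrightarrow>
        (1 / \<psi> a - r / \<phi> a) * 0) (at_right a)"
      using pa by (intro tendsto_intros ratio J) auto
    then show "((\<lambda>x. (1 / \<psi> a - (\<phi> x - \<phi> a) / (\<psi> x - \<psi> a) / \<phi> a) * J x) \<longlongrightarrow> 0) (at_right a)"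
      by simp
  qed
  then show "((\<lambda>x. (V x - V a) / (\<psi> x - \<psi> a)) \<longlongrightarrow> V a / \<psi> a) (at_right a)"
    by (rule LIM_zero_cancel)
qed

end

end

section \<open>Differentiability of the value function at the threshold\<close>

theorem theorem4p1:
  fixes I :: "real set" and M :: "'a measure" and P :: "real \<Rightarrow> 'a measure"
    and X :: "real \<Rightarrow> 'a \<Rightarrow> real" and s :: "real \<Rightarrow> real" and m :: "real measure"
    and p :: "real \<Rightarrow> real \<Rightarrow> real \<Rightarrow> real" and \<phi> \<psi> g :: "real \<Rightarrow> real" and \<alpha> xs :: real
  assumes diffusion: "regular_diffusion I M P X"
    and scale: "scale_function I M P X s"
    and speed: "speed_measure I P X s m"
    and density: "transition_density I M P X m p"
    and alpha: "0 < \<alpha>"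
    and fundamental: "fundamental_solutions I P X s m \<alpha> \<phi> \<psi>"
    and g_nonneg: "\<forall>x\<in>I. 0 \<le> g x"
    and g_lsc: "lower_semicontinuous_on I g"
    and xs: "xs \<in> interior I"
    and Lg_defined: "AE y in m. y \<in> I \<and> xs < y \<longrightarrow> (\<exists>c. has_feller_deriv I s m g y c)"
    and V_integrable: "\<forall>x\<in>I. set_integrable m {y\<in>I. xs < y}
        (\<lambda>y. green_function p \<alpha> x y * (\<alpha> * g y - feller_op I s m g y))"
    and V_eq: "\<forall>x\<in>I. enn2ereal (value_function I M P X \<alpha> g x) =
        ereal (LINT y:{y\<in>I. xs < y}|m.
          green_function p \<alpha> x y * (\<alpha> * g y - feller_op I s m g y))"
  shows "\<exists>D. ((\<lambda>x. (enn2real (value_function I M P X \<alpha> g x) - enn2real (value_function I M P X \<alpha> g xs))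
              / (\<psi> x - \<psi> xs)) \<longlongrightarrow> D) (at xs)"
proof -
  interpret diffusion_density I M P X s m p \<alpha>
    using diffusion speed density alpha by unfold_locales
  have xsI: "xs \<in> I" using xs interior_subset by blast
  obtain e where e: "0 < e" "cball xs e \<subseteq> I"
    using xs by (auto simp: mem_interior_cball)
  then have sub: "{xs - e..xs + e} \<subseteq> I"
    by (auto simp: subset_iff dist_real_def abs_le_iff)
  have sol: "alpha_harmonic I s m \<alpha> \<phi>" "alpha_harmonic I s m \<alpha> \<psi>"
    and pos: "\<And>x. x \<in> I \<Longrightarrow> 0 < \<phi> x" "\<And>x. x \<in> I \<Longrightarrow> 0 < \<psi> x"
    and mono: "strict_mono_on I \<psi>"
    and hit: "\<And>x z. x \<in> I \<Longrightarrow> z \<in> I \<Longrightarrow> x \<le> z \<Longrightarrow> discounted_hitting P X \<alpha> x z = \<psi> x / \<psi> z"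
      "\<And>x z. x \<in> I \<Longrightarrow> z \<in> I \<Longrightarrow> z \<le> x \<Longrightarrow> discounted_hitting P X \<alpha> x z = \<phi> x / \<phi> z"
    using fundamental unfolding fundamental_solutions_def by blast+
  have s: "continuous_on I s" "strict_mono_on I s"
    using scale by (simp_all add: scale_function_def)
  \<comment> \<open>At the interior point \<open>xs\<close> the Feller derivative takes its interior
    form, with values positive because \<alpha>, \<phi> and \<psi> are.\<close>
  have feller: "has_feller_deriv_interior s m \<phi> xs (\<alpha> * \<phi> xs)"
    "has_feller_deriv_interior s m \<psi> xs (\<alpha> * \<psi> xs)"
    using sol xs xsI by (auto simp: alpha_harmonic_def has_feller_deriv_def)
  have "\<exists>d>0. has_right_scale_deriv s \<psi> xs d"
  proof (rule right_scale_deriv_pos[OF _ _ _ _ _ _ feller(2)])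
    show "continuous_on {xs - e..xs + e} s" "continuous_on {xs - e..xs + e} \<psi>"
      using s(1) sol(2) sub by (auto intro: continuous_on_subset simp: alpha_harmonic_def)
    show "strict_mono_on {xs - e..xs + e} s" "strict_mono_on {xs - e..xs + e} \<psi>"
      using s(2) mono sub by (auto intro: monotone_on_subset)
  qed (use e alpha pos xsI in auto)
  then obtain d where d: "0 < d" "has_right_scale_deriv s \<psi> xs d" by blast
  obtain d' where d': "has_right_scale_deriv s \<phi> xs d'"
    using feller(1) unfolding has_feller_deriv_interior_def by (auto dest: eventually_nhds_x_imp_x)
  have ratio: "((\<lambda>x. (\<phi> x - \<phi> xs) / (\<psi> x - \<psi> xs)) \<longlongrightarrow> d' / d) (at_right xs)"
  proof (rule tendsto_quotient_of_scale_derivs[OF _ _ d' d(2)])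
    show "strict_mono_on {xs..xs + e} s"
      using sub e by (intro monotone_on_subset[OF s(2)]) auto
  qed (use e d in auto)
  \<comment> \<open>\<open>V_eq\<close> equates the value with a real number, so it is finite and
    \<open>enn2real\<close> loses nothing.\<close>
  have V: "enn2real (value_function I M P X \<alpha> g x) = (LINT y:{y\<in>I. xs < y}|m.
      green_function p \<alpha> x y * (\<alpha> * g y - feller_op I s m g y))" if "x \<in> I" for x
    using V_eq that by (simp add: enn2real_def)
  show ?thesis
    by (intro exI) (rule differentiable_value[OF xsI pos hit V_integrable[rule_format] V xs mono ratio])
qed

end
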